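(* Let $\alpha>-1$ and $\beta>-1$ be real numbers. Then, as $r\to+\infty$, $$\sum_{l=1}^{\infty}(l+\beta)^{\alpha}J_l(r)^2=\frac{2^{-\alpha-1}\Gamma(\alpha+1)}{\Gamma\left(\frac\alpha2+1\right)^2}\,r^\alpha+o(r^\alpha),$$ $$\sum_{l=1}^{\infty}(l+\beta)^{\alpha}J_l(r)J_l'(r)=o(r^\alpha),$$ $$\sum_{l=1}^{\infty}(l+\beta)^{\alpha}J_l'(r)^2=\frac{\Gamma\left(\frac{\alpha+1}{2}\right)}{4\sqrt\pi\,\Gamma\left(\frac\alpha2+2\right)}\,r^\alpha+o(r^\alpha),$$ $$\sum_{l=1}^{\infty}(l+\beta)^{\alpha}J_l(r)J_l''(r)=-\frac{\Gamma\left(\frac{\alpha+1}{2}\right)}{4\sqrt\pi\,\Gamma\left(\frac\alpha2+2\right)}\,r^\alpha+o(r^\alpha),$$ $$\sum_{l=1}^{\infty}(l+\beta)^{\alpha}J_l'(r)J_l''(r)=o(r^\alpha),$$ $$\sum_{l=1}^{\infty}(l+\beta)^{\alpha}J_l''(r)^2=\frac{3\cdot2^{-\alpha-5}(\alpha+2)(\alpha+4)\Gamma(\alpha+1)}{\Gamma\left(\frac\alpha2+3\right)^2}\,r^\alpha+o(r^\alpha).$$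
   Context: $J_l$ denotes the Bessel function of the first kind of order $l$; $J_l'$, $J_l''$ are its first and second derivatives. *)

theory Defs
  imports "HOL-Analysis.Analysis" "HOL-Library.Landau_Symbols"
begin

text \<open>
  Bessel function of the first kind of integer order \<open>l \<ge> 0\<close>. The defining power series
  converges for every real \<open>x\<close>; the usual factor \<open>\<Gamma>(k + l + 1)\<close> is written \<open>(k + l)!\<close>.
\<close>

definition bessel_J :: "nat \<Rightarrow> real \<Rightarrow> real" where
  "bessel_J l x = (\<Sum>k. (-1) ^ k / (fact k * fact (k + l)) * (x / 2) ^ (2 * k + l))"

end

theory Submission
  imports Defs "HOL-Real_Asymp.Real_Asymp"
begin

text \<open>
  The measures \<open>\<Sum>\<^sub>l J\<^sub>l(r)\<^sup>2 \<delta>\<^bsub>l/r\<^esub>\<close> converge to the arcsine law \<open>ds / (\<pi> sqrt (1 - s\<^sup>2))\<close> on \<open>[0, 1]\<close>.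
  Their even moments follow by induction from \<open>J\<^sub>0\<^sup>2 + 2 \<Sum>\<^sub>l J\<^sub>l\<^sup>2 = 1\<close>, from
  \<open>4 (l/r) J\<^sub>l J\<^sub>l' = J\<^bsub>l-1\<^esub>\<^sup>2 - J\<^bsub>l+1\<^esub>\<^sup>2\<close> (which expresses the derivative of a moment through lower moments)
  and l'Hopital's rule. Polynomial approximation gives all moments of order \<open>\<alpha> > -1\<close>; the singularity at
  \<open>0\<close> is controlled by the Sonin-type bound \<open>J\<^sub>l(r)\<^sup>2 \<le> C / r\<close>, uniform in \<open>l \<le> r/2\<close>.
  The remaining sums reduce to this one: \<open>J\<^sub>l'\<^sup>2 = (J\<^bsub>l-1\<^esub>\<^sup>2 + J\<^bsub>l+1\<^esub>\<^sup>2) / 2 - (l/r)\<^sup>2 J\<^sub>l\<^sup>2\<close>,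
  Bessel's equation eliminates \<open>J\<^sub>l''\<close>, and the sum of \<open>J\<^sub>l J\<^sub>l'\<close> is half the derivative of the sum of \<open>J\<^sub>l\<^sup>2\<close>,
  whose second derivative is \<open>o(r powr \<alpha>)\<close> because the limits for \<open>J\<^sub>l'\<^sup>2\<close> and \<open>J\<^sub>l J\<^sub>l''\<close> cancel.
\<close>

section \<open>Recurrences and termwise bounds\<close>

text \<open>All limits are obtained without a rate, so each step has to survive small-o errors. The
  even moments close under differentiation because the derivative of the moment of order
  \<open>2 * k + 2\<close> telescopes into a sum weighted by a central difference of
  \<open>n ^ (2 * k + 1)\<close>, which is asymptotic to a multiple of \<open>n ^ (2 * k)\<close>;
  the total mass starts the induction. Convergence of moments controls continuous test functions
  only. For negative \<alpha> the function s^\<alpha> is unbounded at 0, hence the need for a bound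
  on each J_l that does not depend on l. It exists because the energy increases in x for l \<ge> 1
  and all orders share a bound for its values near infinity. A possible circle shapes the derivative
  sums: the limit for J_l J_l'' involves the sum of J_l J_l' divided by r, while the sum of J_l J_l'
  itself is only reached through that limit. A crude bound handles the quotient and breaks the
  circle.\<close>

abbreviation (input) "dJ l \<equiv> deriv (bessel_J l)"
abbreviation (input) "ddJ l \<equiv> deriv (deriv (bessel_J l))"

text \<open>This is the Bessel-Clifford function at \<open>-y\<close>. Splitting
  \<open>(x / 2) ^ l\<close> off J_l leaves a power series in \<open>(x / 2)\<^sup>2\<close>, to
  which termwise differentiation applies directly.\<close>

definition bessel_aux :: "nat \<Rightarrow> real \<Rightarrow> real" where
  "bessel_aux l y = (\<Sum>k. (-1) ^ k / (fact k * fact (k + l)) * y ^ k)"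

lemma bessel_aux_term_le:
  "\<bar>(-1) ^ k / (fact k * fact (k + l)) * y ^ k\<bar> \<le> (1 / fact l) * (\<bar>y\<bar> ^ k / fact k)" for y :: real
proof -
  have "(fact l :: real) \<le> fact (k + l)" by (rule fact_mono) simp
  then have "1 / (fact k * fact (k + l)) \<le> 1 / (fact k * fact l :: real)"
    by (intro divide_left_mono mult_left_mono) auto
  then have "1 / (fact k * fact (k + l)) * \<bar>y\<bar> ^ k \<le> 1 / (fact k * fact l) * \<bar>y\<bar> ^ k"
    by (rule mult_right_mono) auto
  then show ?thesis by (simp add: abs_mult power_abs mult_ac)
qed

lemma sums_exp_real: "(\<lambda>k. y ^ k / fact k) sums exp (y :: real)"
  using exp_converges[of y] by (simp add: divide_inverse mult.commute)

lemma summable_bessel_aux: "summable (\<lambda>k. (-1) ^ k / (fact k * fact (k + l)) * (y :: real) ^ k)"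
proof (rule summable_comparison_test')
  show "summable (\<lambda>k. (1 / fact l) * (\<bar>y\<bar> ^ k / fact k))"
    by (rule summable_mult) (rule sums_summable[OF sums_exp_real])
  show "norm ((-1) ^ k / (fact k * fact (k + l)) * y ^ k) \<le> (1 / fact l) * (\<bar>y\<bar> ^ k / fact k)" if "k \<ge> 0" for k
    unfolding real_norm_def by (rule bessel_aux_term_le)
qed

lemma abs_bessel_aux_le: "\<bar>bessel_aux l y\<bar> \<le> exp \<bar>y\<bar> / fact l"
proof -
  note s = sums_mult[OF sums_exp_real[of "\<bar>y\<bar>"], of "1 / fact l"]
  have "norm (bessel_aux l y) \<le> (\<Sum>k. (1 / fact l) * (\<bar>y\<bar> ^ k / fact k))"
    unfolding bessel_aux_def
    by (rule norm_suminf_le[OF _ sums_summable[OF s]]) (simp only: real_norm_def bessel_aux_term_le)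
  then show ?thesis using sums_unique[OF s] by simp
qed

lemma bessel_aux_deriv: "(bessel_aux l has_real_derivative - bessel_aux (Suc l) y) (at y)"
proof -
  let ?c = "\<lambda>k. (-1) ^ k / (fact k * fact (k + l)) :: real"
  have "diffs ?c k * y ^ k = - ((-1) ^ k / (fact k * fact (k + Suc l)) * y ^ k)" for k
  proof -
    have "diffs ?c k = - ((-1) ^ k / (fact k * fact (k + Suc l)))"
      by (simp add: diffs_def fact_Suc[of k] del: of_nat_Suc)
    then show ?thesis by simp
  qed
  then have "(\<Sum>k. diffs ?c k * y ^ k) = - bessel_aux (Suc l) y"
    using summable_bessel_aux[of "Suc l" y] by (simp add: bessel_aux_def suminf_minus)
  then show ?thesis
    using termdiffs_strong_converges_everywhere[of ?c y] summable_bessel_aux[of l]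
    unfolding bessel_aux_def[abs_def] by simp
qed

text \<open>Coefficients are compared: those of order \<open>l\<close> and of order
  \<open>Suc l\<close> times \<open>Suc l\<close> cancel in the constant term, and what remains is
  \<open>-y\<close> times the series of order \<open>l + 2\<close>.\<close>

lemma bessel_aux_recurrence:
  "bessel_aux l y = real (Suc l) * bessel_aux (Suc l) y - y * bessel_aux (Suc (Suc l)) y"
proof -
  let ?t = "\<lambda>l k. (-1) ^ k / (fact k * fact (k + l)) * y ^ k :: real"
  let ?h = "\<lambda>k. ?t l k - real (Suc l) * ?t (Suc l) k"
  have h: "?h sums (bessel_aux l y - real (Suc l) * bessel_aux (Suc l) y)"
    unfolding bessel_aux_def by (intro sums_diff sums_mult summable_sums summable_bessel_aux)
  \<comment> \<open>Dropping the initial term changes nothing, since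
    \<open>?h 0 = 1 / fact l - (l + 1) / fact (l + 1) = 0\<close>.\<close>
  have "(\<lambda>k. ?h (Suc k)) sums (bessel_aux l y - real (Suc l) * bessel_aux (Suc l) y)"
    using sums_split_initial_segment[OF h, of 1] by simp
  moreover have "?h (Suc k) = - y * ?t (Suc (Suc l)) k" for k
  proof -
    define F :: real where "F = fact (Suc (k + l))"
    have F: "fact (Suc k + l) = F" "fact (Suc k + Suc l) = real (k + l + 2) * F"
      "fact (k + Suc (Suc l)) = real (k + l + 2) * F"
      by (simp_all add: F_def fact_Suc[of "Suc (k + l)"])
    define a b P :: real where "a = real (Suc k)" and "b = real (Suc l)"
      and "P = (-1) ^ Suc k * y ^ Suc k / (fact k * F)"
    have ab: "a > 0" "a + b > 0" "real (k + l + 2) = a + b" by (auto simp: a_def b_def)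
    have "?h (Suc k) = P / a - b * (P / (a * (a + b)))"
      unfolding F ab(3) fact_Suc[of k] P_def by (simp add: a_def b_def mult_ac del: of_nat_Suc)
    also have "\<dots> = P / (a + b)"
    proof -
      have "a \<noteq> 0" "a + b \<noteq> 0" using ab by auto
      then show ?thesis by (simp add: divide_simps) (simp add: algebra_simps)
    qed
    also have "\<dots> = - y * ?t (Suc (Suc l)) k"
      unfolding F ab(3) P_def by (simp add: mult_ac)
    finally show ?thesis .
  qed
  ultimately have "(\<lambda>k. - y * ?t (Suc (Suc l)) k) sums (bessel_aux l y - real (Suc l) * bessel_aux (Suc l) y)"
    by simp
  moreover have "(\<lambda>k. - y * ?t (Suc (Suc l)) k) sums (- y * bessel_aux (Suc (Suc l)) y)"
    unfolding bessel_aux_def by (intro sums_mult summable_sums summable_bessel_aux)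
  ultimately have "bessel_aux l y - real (Suc l) * bessel_aux (Suc l) y = - y * bessel_aux (Suc (Suc l)) y"
    by (rule sums_unique2)
  then show ?thesis by simp
qed

lemma bessel_J_eq_aux: "bessel_J l x = (x / 2) ^ l * bessel_aux l ((x / 2)\<^sup>2)"
proof -
  have "(x / 2) ^ (2 * k + l) = (x / 2) ^ l * ((x / 2)\<^sup>2) ^ k" for k
    by (metis power_add power_mult mult.commute)
  then have "(-1) ^ k / (fact k * fact (k + l)) * (x / 2) ^ (2 * k + l)
      = (x / 2) ^ l * ((-1) ^ k / (fact k * fact (k + l)) * ((x / 2)\<^sup>2) ^ k)" for k
    by (simp only: mult_ac)
  then show ?thesis
    unfolding bessel_J_def bessel_aux_def by (simp only: suminf_mult[OF summable_bessel_aux])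
qed

lemma abs_bessel_J_le: "\<bar>bessel_J l x\<bar> \<le> (\<bar>x\<bar> / 2) ^ l / fact l * exp ((x / 2)\<^sup>2)"
proof -
  have "\<bar>bessel_J l x\<bar> = (\<bar>x\<bar> / 2) ^ l * \<bar>bessel_aux l ((x / 2)\<^sup>2)\<bar>"
    by (simp add: bessel_J_eq_aux abs_mult power_abs power_divide)
  also have "\<dots> \<le> (\<bar>x\<bar> / 2) ^ l * (exp \<bar>(x / 2)\<^sup>2\<bar> / fact l)"
    by (intro mult_left_mono abs_bessel_aux_le) auto
  finally show ?thesis by simp
qed

lemma bessel_J_recurrence:
  assumes "x \<noteq> 0"
  shows "bessel_J (Suc (Suc l)) x = 2 * real (Suc l) / x * bessel_J (Suc l) x - bessel_J l x"
  unfolding bessel_J_eq_aux bessel_aux_recurrence[of l "(x/2)\<^sup>2"]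
  using assms by (simp add: field_simps power2_eq_square)

lemma bessel_J_has_deriv:
  assumes "x \<noteq> 0"
  shows "(bessel_J l has_real_derivative real l / x * bessel_J l x - bessel_J (Suc l) x) (at x)"
proof -
  have "((\<lambda>x. (x / 2) ^ l * bessel_aux l ((x / 2)\<^sup>2)) has_real_derivative
      real l * (x / 2) ^ (l - 1) * (1 / 2) * bessel_aux l ((x / 2)\<^sup>2)
      + (x / 2) ^ l * (- bessel_aux (Suc l) ((x / 2)\<^sup>2) * (x / 2))) (at x)"
    by (auto intro!: derivative_eq_intros DERIV_chain2[OF bessel_aux_deriv])
  moreover have "real l * (x / 2) ^ (l - 1) * (1 / 2) * bessel_aux l ((x / 2)\<^sup>2)
      + (x / 2) ^ l * (- bessel_aux (Suc l) ((x / 2)\<^sup>2) * (x / 2))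
      = real l / x * bessel_J l x - bessel_J (Suc l) x"
    using assms by (cases l) (auto simp: bessel_J_eq_aux field_simps)
  moreover have "bessel_J l = (\<lambda>x. (x / 2) ^ l * bessel_aux l ((x / 2)\<^sup>2))"
    by (rule ext) (rule bessel_J_eq_aux)
  ultimately show ?thesis by simp
qed

lemma dJ_eq: "x \<noteq> 0 \<Longrightarrow> dJ l x = real l / x * bessel_J l x - bessel_J (Suc l) x"
  by (rule DERIV_imp_deriv) (rule bessel_J_has_deriv)

lemma DERIV_bessel_J: "x \<noteq> 0 \<Longrightarrow> (bessel_J l has_real_derivative dJ l x) (at x)"
  using bessel_J_has_deriv dJ_eq by simp

lemma dJ_Suc_eq:
  assumes "x \<noteq> 0"
  shows "dJ (Suc l) x = bessel_J l x - real (Suc l) / x * bessel_J (Suc l) x"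
  using assms by (simp add: dJ_eq bessel_J_recurrence del: of_nat_Suc)

text \<open>This is Bessel's equation solved for the second derivative: the formula for J_l' in
  terms of J_l and J_(l+1) is differentiated, then J_(l+1)' and J_(l+1) are eliminated by the two
  first-order relations.\<close>

lemma dJ_has_deriv:
  assumes "x \<noteq> 0"
  shows "(dJ l has_real_derivative - dJ l x / x - (1 - (real l / x)\<^sup>2) * bessel_J l x) (at x)"
proof -
  have "((\<lambda>x. real l / x * bessel_J l x - bessel_J (Suc l) x) has_real_derivative
      (- real l / x\<^sup>2) * bessel_J l x + real l / x * dJ l x - dJ (Suc l) x) (at x)"
    using assms DERIV_bessel_J[OF assms]
    by (auto intro!: derivative_eq_intros simp: power2_eq_square field_simps)
  moreover have "(- real l / x\<^sup>2) * bessel_J l x + real l / x * dJ l x - dJ (Suc l) x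
      = - dJ l x / x - (1 - (real l / x)\<^sup>2) * bessel_J l x"
    unfolding dJ_Suc_eq[OF assms] dJ_eq[OF assms, of l] using assms
    by (simp add: field_simps power2_eq_square)
  \<comment> \<open>The formula for \<open>dJ l\<close> holds only off 0, so the derivative is
    transferred along a neighbourhood of \<open>x\<close> that avoids 0.\<close>
  moreover have "eventually (\<lambda>y. y \<in> - {0}) (nhds x)"
    using assms by (intro eventually_nhds_in_open) auto
  then have "eventually (\<lambda>y. dJ l y = real l / y * bessel_J l y - bessel_J (Suc l) y) (nhds x)"
    by eventually_elim (simp add: dJ_eq)
  ultimately show ?thesis by (subst DERIV_cong_ev[OF refl _ refl]) simp_all
qed

lemma ddJ_eq: "x \<noteq> 0 \<Longrightarrow> ddJ l x = - dJ l x / x - (1 - (real l / x)\<^sup>2) * bessel_J l x"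
  by (rule DERIV_imp_deriv) (rule dJ_has_deriv)

lemma DERIV_dJ: "x \<noteq> 0 \<Longrightarrow> (dJ l has_real_derivative ddJ l x) (at x)"
  using dJ_has_deriv ddJ_eq by simp

section \<open>Geometric domination in the order and termwise differentiation\<close>

text \<open>Decay in the order, locally uniform on the positive half-line. The ratio
  \<open>q\<close> is kept explicit because ratios multiply under products: a factor
  \<open>l / x\<close> costs ratio 2, and two factors of ratio 1/2 give the ratio 1/4 used for every
  series below.\<close>

definition geo_dom :: "real \<Rightarrow> (nat \<Rightarrow> real \<Rightarrow> real) \<Rightarrow> bool" where
  "geo_dom q f \<longleftrightarrow> (\<forall>\<rho>>0. \<forall>R. \<exists>K. \<forall>l. \<forall>x\<in>{\<rho>..R}. \<bar>f l x\<bar> \<le> K * q ^ l)"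

lemma geo_domI:
  assumes "\<And>\<rho> R. \<rho> > 0 \<Longrightarrow> R \<ge> \<rho> \<Longrightarrow> \<exists>K. \<forall>l. \<forall>x\<in>{\<rho>..R}. \<bar>f l x\<bar> \<le> K * q ^ l"
  shows "geo_dom q f"
  unfolding geo_dom_def
proof (intro allI impI)
  fix \<rho> R :: real assume "\<rho> > 0"
  then show "\<exists>K. \<forall>l. \<forall>x\<in>{\<rho>..R}. \<bar>f l x\<bar> \<le> K * q ^ l"
    using assms[of \<rho> R] by (cases "R \<ge> \<rho>") auto
qed

lemma geo_domE:
  assumes "geo_dom q f" "\<rho> > 0" "R \<ge> \<rho>" "q > 0"
  obtains K where "K \<ge> 0" "\<And>l x. x \<in> {\<rho>..R} \<Longrightarrow> \<bar>f l x\<bar> \<le> K * q ^ l"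
proof -
  obtain K where K: "\<forall>l. \<forall>x\<in>{\<rho>..R}. \<bar>f l x\<bar> \<le> K * q ^ l"
    using assms unfolding geo_dom_def by blast
  have "\<bar>f 0 R\<bar> \<le> K" using bspec[OF spec[OF K, of 0], of R] assms(3) by simp
  then have "K \<ge> 0" by linarith
  with K show ?thesis using that by blast
qed

lemma geo_dom_mult:
  assumes "geo_dom p f" "geo_dom q g" "p > 0" "q > 0"
  shows "geo_dom (p * q) (\<lambda>l x. f l x * g l x)"
proof (rule geo_domI)
  fix \<rho> R :: real assume r: "\<rho> > 0" "R \<ge> \<rho>"
  obtain K where K: "K \<ge> 0" "\<And>l x. x \<in> {\<rho>..R} \<Longrightarrow> \<bar>f l x\<bar> \<le> K * p ^ l"
    using geo_domE[OF assms(1) r assms(3)] by metis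
  obtain L where L: "L \<ge> 0" "\<And>l x. x \<in> {\<rho>..R} \<Longrightarrow> \<bar>g l x\<bar> \<le> L * q ^ l"
    using geo_domE[OF assms(2) r assms(4)] by metis
  have "\<bar>f l x * g l x\<bar> \<le> (K * L) * (p * q) ^ l" if "x \<in> {\<rho>..R}" for l x
  proof -
    have "\<bar>f l x\<bar> * \<bar>g l x\<bar> \<le> (K * p ^ l) * (L * q ^ l)"
      using K L that assms by (intro mult_mono) auto
    then show ?thesis by (simp add: abs_mult power_mult_distrib mult_ac)
  qed
  then show "\<exists>K. \<forall>l. \<forall>x\<in>{\<rho>..R}. \<bar>f l x * g l x\<bar> \<le> K * (p * q) ^ l" by blast
qed

lemma geo_dom_add:
  assumes "geo_dom q f" "geo_dom q g" "q > 0"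
  shows "geo_dom q (\<lambda>l x. f l x + g l x)"
proof (rule geo_domI)
  fix \<rho> R :: real assume r: "\<rho> > 0" "R \<ge> \<rho>"
  obtain K where K: "\<And>l x. x \<in> {\<rho>..R} \<Longrightarrow> \<bar>f l x\<bar> \<le> K * q ^ l"
    using geo_domE[OF assms(1) r assms(3)] by metis
  obtain L where L: "\<And>l x. x \<in> {\<rho>..R} \<Longrightarrow> \<bar>g l x\<bar> \<le> L * q ^ l"
    using geo_domE[OF assms(2) r assms(3)] by metis
  have "\<bar>f l x + g l x\<bar> \<le> (K + L) * q ^ l" if "x \<in> {\<rho>..R}" for l x
    using K[OF that, of l] L[OF that, of l] by (simp add: distrib_right)
  then show "\<exists>K. \<forall>l. \<forall>x\<in>{\<rho>..R}. \<bar>f l x + g l x\<bar> \<le> K * q ^ l" by blast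
qed

lemma geo_dom_cmult:
  assumes "geo_dom q f" "q > 0" shows "geo_dom q (\<lambda>l x. c * f l x)"
proof (rule geo_domI)
  fix \<rho> R :: real assume r: "\<rho> > 0" "R \<ge> \<rho>"
  obtain K where K: "\<And>l x. x \<in> {\<rho>..R} \<Longrightarrow> \<bar>f l x\<bar> \<le> K * q ^ l"
    using geo_domE[OF assms(1) r assms(2)] by metis
  have "\<bar>c * f l x\<bar> \<le> (\<bar>c\<bar> * K) * q ^ l" if "x \<in> {\<rho>..R}" for l x
    using mult_left_mono[OF K[OF that, of l], of "\<bar>c\<bar>"] by (simp add: abs_mult mult_ac)
  then show "\<exists>K. \<forall>l. \<forall>x\<in>{\<rho>..R}. \<bar>c * f l x\<bar> \<le> K * q ^ l" by blast
qed

lemma geo_dom_cong: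
  assumes "\<And>l x. x > 0 \<Longrightarrow> f l x = g l x"
  shows "geo_dom q f \<longleftrightarrow> geo_dom q g"
proof -
  have "(\<forall>l. \<forall>x\<in>{\<rho>..R}. \<bar>f l x\<bar> \<le> K * q ^ l) \<longleftrightarrow> (\<forall>l. \<forall>x\<in>{\<rho>..R}. \<bar>g l x\<bar> \<le> K * q ^ l)"
    if "\<rho> > 0" for \<rho> R K
  proof -
    have "f l x = g l x" if "x \<in> {\<rho>..R}" for l x using assms that \<open>\<rho> > 0\<close> by simp
    then show ?thesis by simp
  qed
  then show ?thesis unfolding geo_dom_def by simp
qed

lemma geo_dom_bessel_J:
  assumes "0 < q" shows "geo_dom q bessel_J"
proof (rule geo_domI)
  fix \<rho> R :: real assume r: "\<rho> > 0" "R \<ge> \<rho>"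
  have "\<bar>bessel_J l x\<bar> \<le> (exp (R / (2 * q)) * exp ((R / 2)\<^sup>2)) * q ^ l" if x: "x \<in> {\<rho>..R}" for l x
  proof -
    \<comment> \<open>One term of the exponential series is at most its sum. The factorial thus
      beats any geometric rate, which is why \<open>q\<close> is arbitrary.\<close>
    have "(R / (2 * q)) ^ l / fact l \<le> exp (R / (2 * q))"
      using r assms sum_le_suminf[OF sums_summable[OF sums_exp_real[of "R / (2 * q)"]], of "{l}"]
        sums_unique[OF sums_exp_real[of "R / (2 * q)"]]
      by simp
    from mult_right_mono[OF this, of "q ^ l"]
    have *: "(R / 2) ^ l / fact l \<le> exp (R / (2 * q)) * q ^ l"
      using assms by (simp add: power_divide power_mult_distrib)
    have "\<bar>bessel_J l x\<bar> \<le> (\<bar>x\<bar> / 2) ^ l / fact l * exp ((x / 2)\<^sup>2)"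
      by (rule abs_bessel_J_le)
    also have "\<dots> \<le> (R / 2) ^ l / fact l * exp ((R / 2)\<^sup>2)"
      using x r by (intro mult_mono divide_right_mono power_mono) auto
    also have "\<dots> \<le> (exp (R / (2 * q)) * q ^ l) * exp ((R / 2)\<^sup>2)"
      by (intro mult_right_mono *) auto
    finally show ?thesis by (simp add: mult_ac)
  qed
  then show "\<exists>K. \<forall>l. \<forall>x\<in>{\<rho>..R}. \<bar>bessel_J l x\<bar> \<le> K * q ^ l" by blast
qed

lemma geo_dom_index: "geo_dom 2 (\<lambda>l x. real l / x)"
proof (rule geo_domI)
  fix \<rho> R :: real assume r: "\<rho> > 0" "R \<ge> \<rho>"
  have "\<bar>real l / x\<bar> \<le> (1 / \<rho>) * 2 ^ l" if x: "x \<in> {\<rho>..R}" for l x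
  proof -
    have "real l \<le> 2 ^ l" using of_nat_less_two_power[of l, where 'a = real] by simp
    then have "real l / x \<le> 2 ^ l / \<rho>" using x r by (intro frac_le) auto
    then show ?thesis using x r by simp
  qed
  then show "\<exists>K. \<forall>l. \<forall>x\<in>{\<rho>..R}. \<bar>real l / x\<bar> \<le> K * 2 ^ l" by blast
qed

lemma geo_dom_inverse: "geo_dom 1 (\<lambda>l x. 1 / x)"
proof (rule geo_domI)
  fix \<rho> R :: real assume r: "\<rho> > 0" "R \<ge> \<rho>"
  then have "\<forall>l::nat. \<forall>x\<in>{\<rho>..R}. \<bar>1 / x\<bar> \<le> 1 / \<rho> * 1 ^ l" by (auto intro!: frac_le)
  then show "\<exists>K. \<forall>l::nat. \<forall>x\<in>{\<rho>..R}. \<bar>1 / x\<bar> \<le> K * 1 ^ l" by blast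
qed

lemma geo_dom_bessel_J_Suc:
  assumes "0 < q" shows "geo_dom q (\<lambda>l. bessel_J (Suc l))"
proof (rule geo_domI)
  fix \<rho> R :: real assume r: "\<rho> > 0" "R \<ge> \<rho>"
  obtain K where K: "\<And>l x. x \<in> {\<rho>..R} \<Longrightarrow> \<bar>bessel_J l x\<bar> \<le> K * q ^ l"
    using geo_domE[OF geo_dom_bessel_J[OF assms] r assms] by metis
  have "\<bar>bessel_J (Suc l) x\<bar> \<le> (K * q) * q ^ l" if "x \<in> {\<rho>..R}" for l x
    using K[OF that, of "Suc l"] by (simp add: mult_ac)
  then show "\<exists>K. \<forall>l. \<forall>x\<in>{\<rho>..R}. \<bar>bessel_J (Suc l) x\<bar> \<le> K * q ^ l" by blast
qed

lemma geo_dom_dJ: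
  assumes "0 < q" shows "geo_dom q dJ"
proof -
  have "geo_dom q (\<lambda>l x. real l / x * bessel_J l x + (-1) * bessel_J (Suc l) x)"
    using geo_dom_mult[OF geo_dom_index geo_dom_bessel_J[of "q/2"]] assms
    by (intro geo_dom_add geo_dom_cmult geo_dom_bessel_J_Suc) auto
  moreover have "geo_dom q (\<lambda>l x. real l / x * bessel_J l x + (-1) * bessel_J (Suc l) x) \<longleftrightarrow> geo_dom q dJ"
    by (rule geo_dom_cong) (simp add: dJ_eq)
  ultimately show ?thesis by simp
qed

lemma geo_dom_ddJ:
  assumes "0 < q" shows "geo_dom q ddJ"
proof -
  have 1: "geo_dom q (\<lambda>l x. 1 / x * dJ l x)"
    using geo_dom_mult[OF geo_dom_inverse geo_dom_dJ[of q]] assms by simp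
  have 2: "geo_dom q (\<lambda>l x. real l / x * (real l / x * bessel_J l x))"
    using geo_dom_mult[OF geo_dom_index geo_dom_mult[OF geo_dom_index geo_dom_bessel_J[of "q/4"]]] assms
    by simp
  have "geo_dom q (\<lambda>l x. (-1) * (1 / x * dJ l x) + ((-1) * bessel_J l x
      + real l / x * (real l / x * bessel_J l x)))"
    using assms by (intro geo_dom_add geo_dom_cmult geo_dom_bessel_J 1 2) auto
  moreover have "geo_dom q (\<lambda>l x. (-1) * (1 / x * dJ l x) + ((-1) * bessel_J l x
      + real l / x * (real l / x * bessel_J l x))) \<longleftrightarrow> geo_dom q ddJ"
    by (rule geo_dom_cong) (simp add: ddJ_eq algebra_simps power2_eq_square)
  ultimately show ?thesis by simp
qed

text \<open>The base 2 fits the ratio 1/4 of the Bessel products: weight times product still decays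
  like (1/2)^n. All weights of polynomial growth are covered.\<close>

definition subexp :: "(nat \<Rightarrow> real) \<Rightarrow> bool" where
  "subexp w \<longleftrightarrow> Bseq (\<lambda>n. w n / 2 ^ n)"

lemma subexpE:
  assumes "subexp w" obtains C where "C > 0" "\<And>n. \<bar>w n\<bar> \<le> C * 2 ^ n"
proof -
  obtain C where C: "C > 0" "\<And>n. norm (w n / 2 ^ n) \<le> C"
    using assms unfolding subexp_def Bseq_def by blast
  have "\<bar>w n\<bar> \<le> C * 2 ^ n" for n using C(2)[of n] by (simp add: field_simps)
  with C(1) show ?thesis using that by blast
qed

lemma subexp_series_bound:
  assumes "subexp w" "geo_dom (1/4) f" "\<rho> > 0" "R \<ge> \<rho>"
  obtains K where "\<And>n x. x \<in> {\<rho>..R} \<Longrightarrow> norm (w (Suc n) * f (Suc n) x) \<le> K * (1/2) ^ n"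
proof -
  obtain C where C: "C > 0" "\<And>n. \<bar>w n\<bar> \<le> C * 2 ^ n" using subexpE[OF assms(1)] by metis
  obtain K where K: "K \<ge> 0" "\<And>l x. x \<in> {\<rho>..R} \<Longrightarrow> \<bar>f l x\<bar> \<le> K * (1/4) ^ l"
    using geo_domE[OF assms(2-4)] by auto
  have "norm (w (Suc n) * f (Suc n) x) \<le> (C * K / 2) * (1/2) ^ n" if "x \<in> {\<rho>..R}" for n x
  proof -
    have "\<bar>w (Suc n)\<bar> * \<bar>f (Suc n) x\<bar> \<le> (C * 2 ^ Suc n) * (K * (1/4) ^ Suc n)"
      using C(1) K(1) by (intro mult_mono C(2) K(2) that) simp_all
    also have "\<dots> = (C * K / 2) * (2 * (1/4)) ^ n"
      unfolding power_mult_distrib by simp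
    finally show ?thesis by (simp add: abs_mult)
  qed
  then show ?thesis using that by blast
qed

lemma summable_weighted:
  assumes "subexp w" "geo_dom (1/4) f" "x > 0"
  shows "summable (\<lambda>n. w (Suc n) * f (Suc n) x)"
proof -
  obtain K where K: "\<And>n y. y \<in> {x..x} \<Longrightarrow> norm (w (Suc n) * f (Suc n) y) \<le> K * (1/2) ^ n"
    using subexp_series_bound[OF assms(1,2,3) order.refl] by metis
  show ?thesis
  proof (rule summable_comparison_test')
    show "summable (\<lambda>n. K * (1/2) ^ n)" by (intro summable_mult summable_geometric) simp
    show "norm (w (Suc n) * f (Suc n) x) \<le> K * (1/2) ^ n" if "n \<ge> 0" for n by (rule K) simp
  qed
qed

lemma DERIV_weighted:
  assumes "subexp w" "geo_dom (1/4) f" "geo_dom (1/4) f'" "x > 0"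
    and d: "\<And>l x. x > 0 \<Longrightarrow> (f l has_real_derivative f' l x) (at x)"
  shows "((\<lambda>x. \<Sum>n. w (Suc n) * f (Suc n) x) has_real_derivative (\<Sum>n. w (Suc n) * f' (Suc n) x)) (at x)"
proof -
  \<comment> \<open>A compact interval around \<open>x\<close> that stays away from 0, where the
    domination is uniform and the Weierstrass test applies.\<close>
  define S where "S = {x/2..2*x}"
  have S: "x \<in> interior S" "\<And>y. y \<in> S \<Longrightarrow> y > 0" "convex S" using assms(4) by (auto simp: S_def)
  obtain K where K: "\<And>n y. y \<in> S \<Longrightarrow> norm (w (Suc n) * f' (Suc n) y) \<le> K * (1/2) ^ n"
    using subexp_series_bound[OF assms(1,3), of "x/2" "2*x"] assms(4) unfolding S_def by auto
  have u: "uniformly_convergent_on S (\<lambda>n y. \<Sum>i<n. w (Suc i) * f' (Suc i) y)"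
  proof (rule Weierstrass_m_test'[where M = "\<lambda>n. K * (1/2) ^ n"])
    show "summable (\<lambda>n. K * (1/2 :: real) ^ n)" by (intro summable_mult summable_geometric) simp
  qed (rule K)
  have d': "((\<lambda>x. w (Suc n) * f (Suc n) x) has_real_derivative w (Suc n) * f' (Suc n) y) (at y within S)"
    if "y \<in> S" for n y
    by (rule DERIV_cmult, rule has_field_derivative_at_within, rule d, rule S(2), rule that)
  have "x \<in> S" using S(1) interior_subset[of S] by (rule subsetD[rotated])
  from has_field_derivative_series'(2)[OF S(3) d' u this summable_weighted[OF assms(1,2,4)] S(1)]
  show ?thesis .
qed

lemma geo_dom_bessel_products:
  "geo_dom (1/4) (\<lambda>l x. (bessel_J l x)\<^sup>2)"
  "geo_dom (1/4) (\<lambda>l x. bessel_J l x * dJ l x)"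
  "geo_dom (1/4) (\<lambda>l x. (dJ l x)\<^sup>2)"
  "geo_dom (1/4) (\<lambda>l x. bessel_J l x * ddJ l x)"
  "geo_dom (1/4) (\<lambda>l x. dJ l x * ddJ l x)"
  "geo_dom (1/4) (\<lambda>l x. (ddJ l x)\<^sup>2)"
  using geo_dom_mult[of "1/2" _ "1/2"] geo_dom_bessel_J[of "1/2"] geo_dom_dJ[of "1/2"] geo_dom_ddJ[of "1/2"]
  by (simp_all add: power2_eq_square)

lemma subexp_const: "subexp (\<lambda>_. c)"
proof -
  have "(\<lambda>n. c * (1/2) ^ n) \<longlonglongrightarrow> c * 0"
    by (intro tendsto_mult_left LIMSEQ_realpow_zero) auto
  then have "Bseq (\<lambda>n. c * (1/2) ^ n)" by (intro convergent_imp_Bseq convergentI)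
  then show ?thesis by (simp add: subexp_def power_divide)
qed

section \<open>Telescoping identities and the total mass\<close>

lemma bessel_J_tendsto_0:
  assumes "x > 0" shows "(\<lambda>l. bessel_J l x) \<longlonglongrightarrow> 0"
proof -
  have g: "geo_dom (1/2) bessel_J" "(0::real) < 1/2" by (rule geo_dom_bessel_J) simp_all
  obtain K where K: "\<And>l y. y \<in> {x..x} \<Longrightarrow> \<bar>bessel_J l y\<bar> \<le> K * (1/2) ^ l"
    using geo_domE[OF g(1) assms order.refl g(2)] by metis
  have "(\<lambda>l. K * (1/2) ^ l) \<longlonglongrightarrow> K * 0"
    by (intro tendsto_mult_left LIMSEQ_realpow_zero) auto
  then have "(\<lambda>l. K * (1/2) ^ l) \<longlonglongrightarrow> 0" by simp
  moreover have "\<forall>\<^sub>F l in sequentially. norm (bessel_J l x) \<le> K * (1/2) ^ l"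
    unfolding real_norm_def by (intro always_eventually allI K) simp
  ultimately show ?thesis by (rule Lim_null_comparison[rotated])
qed

text \<open>With j = J_l and k = (l+1)/x J_(l+1), the neighbours are J_(l+1)' = j - k and J_(l+2) =
  2k - j, so both claims are polynomial identities. The second telescopes and gives the conservation
  of total mass; the first drives the recursion of the moments.\<close>

lemma bessel_J_times_dJ:
  assumes "x \<noteq> 0"
  shows "real (Suc l) / x * (bessel_J (Suc l) x * dJ (Suc l) x)
    = ((bessel_J l x)\<^sup>2 - (bessel_J (Suc (Suc l)) x)\<^sup>2) / 4"
    and "2 * (bessel_J (Suc l) x * dJ (Suc l) x)
    = bessel_J l x * bessel_J (Suc l) x - bessel_J (Suc l) x * bessel_J (Suc (Suc l)) x"
proof -
  define j k where "j = bessel_J l x" and "k = real (Suc l) / x * bessel_J (Suc l) x"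
  have 1: "dJ (Suc l) x = j - k" "bessel_J (Suc (Suc l)) x = 2 * k - j"
    using assms by (simp_all add: dJ_Suc_eq bessel_J_recurrence j_def k_def del: of_nat_Suc)
  have "k * (j - k) = (j\<^sup>2 - (2 * k - j)\<^sup>2) / 4" by (simp add: power2_eq_square algebra_simps)
  then show "real (Suc l) / x * (bessel_J (Suc l) x * dJ (Suc l) x)
    = ((bessel_J l x)\<^sup>2 - (bessel_J (Suc (Suc l)) x)\<^sup>2) / 4"
    unfolding 1 by (simp add: k_def j_def del: of_nat_Suc)
  show "2 * (bessel_J (Suc l) x * dJ (Suc l) x)
    = bessel_J l x * bessel_J (Suc l) x - bessel_J (Suc l) x * bessel_J (Suc (Suc l)) x"
    unfolding 1 j_def[symmetric] by (simp add: algebra_simps)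
qed

text \<open>Serves to identify the constant total mass by letting x tend to 0. The factor is
  \<open>exp 2 / 4\<close> times the geometric sum 1/(1 - 1/4).\<close>

lemma suminf_bessel_J_squared_le:
  assumes x: "0 < x" "x \<le> 1"
  shows "(\<Sum>n. (bessel_J (Suc n) x)\<^sup>2) \<le> x\<^sup>2 * (exp 2 / 3)"
proof -
  have b: "(bessel_J (Suc n) x)\<^sup>2 \<le> x\<^sup>2 * (exp 2 / 4) * (1/4) ^ n" for n
  proof -
    have "x * x \<le> 1 * 1" using x by (intro mult_mono) auto
    then have "exp ((x / 2)\<^sup>2) \<le> exp 1" by (simp add: power2_eq_square)
    have "\<bar>bessel_J (Suc n) x\<bar> \<le> (\<bar>x\<bar> / 2) ^ Suc n / fact (Suc n) * exp ((x / 2)\<^sup>2)"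
      by (rule abs_bessel_J_le)
    also have "\<dots> \<le> (x / 2 * (1 / 2) ^ n) / 1 * exp 1"
    proof (intro mult_mono frac_le)
      have "(x / 2) ^ n \<le> (1 / 2) ^ n" using x by (intro power_mono) auto
      from mult_left_mono[OF this, of "x / 2"]
      show "(\<bar>x\<bar> / 2) ^ Suc n \<le> x / 2 * (1 / 2) ^ n" using x by simp
    qed (use x \<open>exp ((x / 2)\<^sup>2) \<le> exp 1\<close> in \<open>auto simp del: fact_Suc\<close>)
    finally have "\<bar>bessel_J (Suc n) x\<bar> ^ 2 \<le> (x / 2 * (1 / 2) ^ n * exp 1) ^ 2"
      by (intro power_mono) auto
    also have "\<dots> = x\<^sup>2 * (exp 2 / 4) * ((1/2)\<^sup>2) ^ n"
    proof -
      have "exp (2::real) = exp 1 ^ 2" by (simp add: exp_of_nat_mult[of 2 1, simplified])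
      moreover have "((1/2::real) ^ n)\<^sup>2 = ((1/2)\<^sup>2) ^ n"
        by (simp only: power_mult[symmetric] mult.commute)
      ultimately show ?thesis by (simp only: power_mult_distrib) (simp add: power_divide)
    qed
    finally show ?thesis by (simp add: power_divide)
  qed
  have s: "(\<lambda>n. x\<^sup>2 * (exp 2 / 4) * (1/4) ^ n) sums (x\<^sup>2 * (exp 2 / 4) * (1 / (1 - 1/4)))"
    by (intro sums_mult geometric_sums) auto
  have "summable (\<lambda>n. (bessel_J (Suc n) x)\<^sup>2)"
    using summable_weighted[OF subexp_const[of 1] geo_dom_bessel_products(1) x(1)] by simp
  then have "(\<Sum>n. (bessel_J (Suc n) x)\<^sup>2) \<le> (\<Sum>n. x\<^sup>2 * (exp 2 / 4) * (1/4) ^ n)"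
    by (intro suminf_le b sums_summable[OF s])
  then show ?thesis using sums_unique[OF s] by simp
qed

lemma bessel_J_0_at_0: "bessel_J 0 0 = 1"
proof -
  have "(\<Sum>k. (-1) ^ k / (fact k * fact (k + 0)) * (0::real) ^ k) = (-1) ^ 0 / (fact 0 * fact (0 + 0))"
    by (rule powser_zero)
  then show ?thesis by (simp add: bessel_J_eq_aux bessel_aux_def)
qed

theorem bessel_J_sum_squares:
  assumes "x > 0"
  shows "(\<Sum>n. (bessel_J (Suc n) x)\<^sup>2) = (1 - (bessel_J 0 x)\<^sup>2) / 2"
proof -
  define F where "F x = (bessel_J 0 x)\<^sup>2 + 2 * (\<Sum>n. (bessel_J (Suc n) x)\<^sup>2)" for x
  have d: "(F has_real_derivative 0) (at x)" if "x > 0" for x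
  proof -
    have "((\<lambda>x. \<Sum>n. 1 * (bessel_J (Suc n) x)\<^sup>2) has_real_derivative
        (\<Sum>n. 1 * (2 * (bessel_J (Suc n) x * dJ (Suc n) x)))) (at x)"
    proof (rule DERIV_weighted[OF subexp_const geo_dom_bessel_products(1) _ that])
      show "geo_dom (1/4) (\<lambda>l x. 2 * (bessel_J l x * dJ l x))"
        by (intro geo_dom_cmult geo_dom_bessel_products) auto
      show "((\<lambda>x. (bessel_J l x)\<^sup>2) has_real_derivative 2 * (bessel_J l x * dJ l x)) (at x)"
        if "x > 0" for l x
        using that by (auto intro!: derivative_eq_intros DERIV_bessel_J)
    qed
    moreover have "(\<lambda>n. 2 * (bessel_J (Suc n) x * dJ (Suc n) x)) sums (bessel_J 0 x * bessel_J (Suc 0) x - 0)"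
      unfolding bessel_J_times_dJ(2)[OF less_imp_neq[OF that, symmetric]]
      using bessel_J_tendsto_0[OF that] LIMSEQ_Suc[OF bessel_J_tendsto_0[OF that]]
      by (intro telescope_sums') (auto intro!: tendsto_eq_intros)
    ultimately have "((\<lambda>x. \<Sum>n. (bessel_J (Suc n) x)\<^sup>2) has_real_derivative
        bessel_J 0 x * bessel_J (Suc 0) x) (at x)"
      by (simp add: sums_iff)
    moreover have "(bessel_J 0 has_real_derivative - bessel_J (Suc 0) x) (at x)"
      using bessel_J_has_deriv[of x 0] that by simp
    ultimately show ?thesis
      unfolding F_def[abs_def] by (auto intro!: derivative_eq_intros)
  qed
  \<comment> \<open>\<open>F\<close> is constant on the positive half-line because its derivative
    telescopes to 0. Its value is read off as the limit from the right at 0, where only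
    \<open>bessel_J 0\<close> contributes.\<close>
  have "\<forall>\<^sub>F y in at_right 0. F y = F x"
    unfolding eventually_at_right_field
  proof (intro exI[of _ 1] conjI allI impI)
    fix y :: real assume "0 < y" "y < 1"
    then show "F y = F x"
      using assms by (intro DERIV_isconst3[of 0 "x + 1"] d) auto
  qed simp
  then have 1: "(F \<longlongrightarrow> F x) (at_right 0)" by (rule tendsto_eventually)
  have "(F \<longlongrightarrow> 1\<^sup>2 + 2 * 0) (at_right 0)"
    unfolding F_def[abs_def]
  proof (intro tendsto_add tendsto_power tendsto_mult_left)
    have "isCont (\<lambda>x. bessel_aux 0 ((x / 2)\<^sup>2)) 0"
      by (rule DERIV_isCont) (rule DERIV_chain2[OF bessel_aux_deriv], auto intro!: derivative_eq_intros)
    then have "isCont (bessel_J 0) 0" by (simp add: bessel_J_eq_aux[abs_def])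
    then have "(bessel_J 0 \<longlongrightarrow> bessel_J 0 0) (at 0)" by (rule isContD)
    then show "(bessel_J 0 \<longlongrightarrow> 1) (at_right 0)"
      unfolding bessel_J_0_at_0 by (simp add: filterlim_at_split)
    show "((\<lambda>x. \<Sum>n. (bessel_J (Suc n) x)\<^sup>2) \<longlongrightarrow> 0) (at_right 0)"
    proof (rule Lim_null_comparison)
      show "((\<lambda>x. x\<^sup>2 * (exp 2 / 3)) \<longlongrightarrow> 0) (at_right (0::real))"
        by (auto intro!: tendsto_eq_intros)
      show "\<forall>\<^sub>F x in at_right 0. norm (\<Sum>n. (bessel_J (Suc n) x)\<^sup>2) \<le> x\<^sup>2 * (exp 2 / 3)"
        unfolding eventually_at_right_field
      proof (intro exI[of _ 1] conjI allI impI)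
        fix y :: real assume y: "0 < y" "y < 1"
        have "0 \<le> (\<Sum>n. (bessel_J (Suc n) y)\<^sup>2)"
          using summable_weighted[OF subexp_const[of 1] geo_dom_bessel_products(1) y(1)]
          by (intro suminf_nonneg) auto
        then show "norm (\<Sum>n. (bessel_J (Suc n) y)\<^sup>2) \<le> y\<^sup>2 * (exp 2 / 3)"
          using suminf_bessel_J_squared_le[of y] y by simp
      qed simp
    qed
  qed
  from tendsto_unique[OF _ 1 this] have "F x = 1" by (simp add: trivial_limit_at_right_real)
  then show ?thesis by (simp add: F_def)
qed

section \<open>A uniform bound from Sonin's energy\<close>

text \<open>
  With \<open>u x = sqrt x * J\<^sub>l x\<close>, Bessel's equation reads \<open>u'' + (1 - (l\<^sup>2 - 1/4) / x\<^sup>2) u = 0\<close>;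
  the energy below is \<open>u'\<^sup>2 + (1 - (l\<^sup>2 - 1/4) / x\<^sup>2) u\<^sup>2\<close>.
\<close>

definition bessel_energy :: "nat \<Rightarrow> real \<Rightarrow> real" where
  "bessel_energy l x = x * (dJ l x)\<^sup>2 + bessel_J l x * dJ l x + x * (bessel_J l x)\<^sup>2
     - (real l)\<^sup>2 / x * (bessel_J l x)\<^sup>2 + (bessel_J l x)\<^sup>2 / (2 * x)"

text \<open>For u'' + q u = 0 the derivative of u'^2 + q u^2 is q' u^2, the terms with u'
  cancelling. Here q' has the sign of l^2 - 1/4, so the energy increases for l \<ge> 1 and decreases
  for l = 0.\<close>

lemma bessel_energy_deriv:
  assumes "x > 0"
  shows "(bessel_energy l has_real_derivative 2 * ((real l)\<^sup>2 - 1/4) / x\<^sup>2 * (bessel_J l x)\<^sup>2) (at x)"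
proof -
  have x: "x \<noteq> 0" using assms by simp
  note dJ = DERIV_bessel_J[OF x, of l] and ddJ = DERIV_dJ[OF x, of l]
  have J2: "((\<lambda>x. (bessel_J l x)\<^sup>2) has_real_derivative 2 * (bessel_J l x * dJ l x)) (at x)"
    and dJ2: "((\<lambda>x. (dJ l x)\<^sup>2) has_real_derivative 2 * (dJ l x * ddJ l x)) (at x)"
    using DERIV_power[OF dJ, of 2] DERIV_power[OF ddJ, of 2] by (simp_all add: mult_ac)
  define c where "c = 1/2 - (real l)\<^sup>2"
  note D = DERIV_add[OF DERIV_add[OF DERIV_add[OF DERIV_mult[OF DERIV_ident dJ2] DERIV_mult[OF dJ ddJ]]
        DERIV_mult[OF DERIV_ident J2]] DERIV_cmult[OF DERIV_mult[OF DERIV_inverse[OF x] J2], of c]]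
  have "bessel_energy l = (\<lambda>x. x * (dJ l x)\<^sup>2 + bessel_J l x * dJ l x + x * (bessel_J l x)\<^sup>2
      + c * (inverse x * (bessel_J l x)\<^sup>2))"
    by (rule ext) (simp add: bessel_energy_def c_def inverse_eq_divide left_diff_distrib diff_divide_distrib)
  then show ?thesis
    by (simp only:) (rule DERIV_cong[OF D],
      use x in \<open>simp add: ddJ_eq c_def power2_eq_square divide_simps\<close>, use x in \<open>simp add: algebra_simps\<close>)
qed

text \<open>Completing the square shows that the energy controls J_l^2 wherever x^2 exceeds l^2 by a
  fixed proportion.\<close>

lemma bessel_energy_square:
  assumes "x > 0"
  shows "x * bessel_energy l x
    = (x * dJ l x + bessel_J l x / 2)\<^sup>2 + (x\<^sup>2 - (real l)\<^sup>2 + 1/4) * (bessel_J l x)\<^sup>2"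
  using assms unfolding bessel_energy_def
  by (simp add: power2_eq_square divide_simps) (simp add: algebra_simps)

lemma bessel_energy_mono:
  assumes "l > 0" "0 < x" "x \<le> y"
  shows "bessel_energy l x \<le> bessel_energy l y"
proof (rule DERIV_nonneg_imp_nondecreasing[OF assms(3)])
  fix z assume "x \<le> z" "z \<le> y"
  then have "z > 0" using assms by simp
  have "1 \<le> real l" using assms by simp
  then have "1 * 1 \<le> real l * real l" by (intro mult_mono) auto
  then have "2 * ((real l)\<^sup>2 - 1/4) / z\<^sup>2 * (bessel_J l z)\<^sup>2 \<ge> 0" by (simp add: power2_eq_square)
  with bessel_energy_deriv[OF \<open>z > 0\<close>]
  show "\<exists>d. DERIV (bessel_energy l) z :> d \<and> d \<ge> 0" by blast
qed

text \<open>Order 0 is the exceptional one, with l^2 - 1/4 negative. Its energy at 1 therefore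
  bounds it for all x \<ge> 1 and supplies the absolute constant from which the other orders inherit
  theirs.\<close>

lemma bessel_energy_0_antimono:
  assumes "0 < x" "x \<le> y"
  shows "bessel_energy 0 y \<le> bessel_energy 0 x"
proof (rule DERIV_nonpos_imp_nonincreasing[OF assms(2)])
  fix z assume "x \<le> z" "z \<le> y"
  then have "z > 0" using assms by simp
  have "2 * ((real 0)\<^sup>2 - 1/4) / z\<^sup>2 * (bessel_J 0 z)\<^sup>2 \<le> 0" by simp
  with bessel_energy_deriv[OF \<open>z > 0\<close>]
  show "\<exists>d. DERIV (bessel_energy 0) z :> d \<and> d \<le> 0" by blast
qed

lemma bessel_0_amplitude:
  assumes "x \<ge> 1"
  shows "x * (bessel_J 0 x)\<^sup>2 \<le> bessel_energy 0 1"
    and "x * ((bessel_J 0 x)\<^sup>2 + (dJ 0 x)\<^sup>2) \<le> 4 * bessel_energy 0 1"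
proof -
  define j d B where "j = bessel_J 0 x" and "d = dJ 0 x" and "B = bessel_energy 0 1"
  have "bessel_energy 0 x \<le> B" unfolding B_def using assms by (intro bessel_energy_0_antimono) auto
  then have "x * bessel_energy 0 x \<le> x * B" using assms by (intro mult_left_mono) auto
  then have 1: "(x * d + j / 2)\<^sup>2 + (x\<^sup>2 + 1/4) * j\<^sup>2 \<le> x * B"
    using bessel_energy_square[of x 0] assms by (simp add: j_def d_def)
  have "(x * d + j / 2)\<^sup>2 + (x\<^sup>2 + 1/4) * j\<^sup>2 = x * (x * j\<^sup>2) + ((x * d + j / 2)\<^sup>2 + j\<^sup>2 / 4)"
    by (simp add: power2_eq_square algebra_simps)
  moreover have "0 \<le> (x * d + j / 2)\<^sup>2 + j\<^sup>2 / 4" by simp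
  ultimately have "x * (x * j\<^sup>2) \<le> (x * d + j / 2)\<^sup>2 + (x\<^sup>2 + 1/4) * j\<^sup>2" by linarith
  with 1 have "x * (x * j\<^sup>2) \<le> x * B" by linarith
  then have 2: "x * j\<^sup>2 \<le> B" using assms by simp
  then show "x * (bessel_J 0 x)\<^sup>2 \<le> bessel_energy 0 1" by (simp add: j_def B_def)
  \<comment> \<open>Parallelogram law for \<open>x * d + j / 2\<close> and \<open>j / 2\<close>. It
    gives x d^2 \<le> 2B next to x j^2 \<le> B; the factor 4 in the conclusion is generous.\<close>
  have "2 * (x * d + j / 2)\<^sup>2 + j\<^sup>2 / 2 = x * (x * d\<^sup>2) + (x * d + j)\<^sup>2"
    by (simp add: power2_eq_square field_simps)
  then have "x * (x * d\<^sup>2) \<le> 2 * (x * d + j / 2)\<^sup>2 + j\<^sup>2 / 2" by simp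
  also have "\<dots> \<le> 2 * ((x * d + j / 2)\<^sup>2 + (x\<^sup>2 + 1/4) * j\<^sup>2)" by (simp add: algebra_simps)
  also have "\<dots> \<le> x * (2 * B)" using 1 by simp
  finally have "x * d\<^sup>2 \<le> 2 * B" using assms by simp
  moreover have "0 \<le> x * j\<^sup>2" using assms by simp
  ultimately have "x * (j\<^sup>2 + d\<^sup>2) \<le> 4 * B" using 2 by (simp add: distrib_left)
  then show "x * ((bessel_J 0 x)\<^sup>2 + (dJ 0 x)\<^sup>2) \<le> 4 * bessel_energy 0 1"
    by (simp add: j_def d_def B_def)
qed

text \<open>If j, d are J_l, J_l' and L = l, then p, q are J_(l+1), J_(l+1)'. To leading order (p,
  q) = (-d, j). The three summands of \<kappa> bound, in turn, the error in p^2, the cross term in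
  q^2 and the quadratic term in q^2, with 1/x^2 replaced by 1/x.\<close>

lemma rotation_step_bound:
  fixes x L j d p q :: real
  assumes "x \<ge> 1" "L \<ge> 0" "p = L / x * j - d" "q = j - (L + 1) / x * p"
  defines "\<kappa> \<equiv> (L + L\<^sup>2) + (L + 1) * (2 + L + L\<^sup>2) + (L + 1)\<^sup>2 * (1 + L + L\<^sup>2)"
  shows "p\<^sup>2 + q\<^sup>2 \<le> (j\<^sup>2 + d\<^sup>2) * (1 + \<kappa> / x)"
proof -
  define s h where "s = j\<^sup>2 + d\<^sup>2" and "h = 1 / x"
  have h: "0 < h" "h \<le> 1" using assms by (auto simp: h_def)
  have hh: "h\<^sup>2 \<le> h" using h by (simp add: power2_eq_square mult_left_le)
  have s: "s \<ge> 0" "j\<^sup>2 \<le> s" by (auto simp: s_def)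
  have ab: "2 * \<bar>a * b\<bar> \<le> a\<^sup>2 + b\<^sup>2" for a b :: real
    using sum_squares_bound[of "\<bar>a\<bar>" "\<bar>b\<bar>"] by (simp add: abs_mult)
  have "p\<^sup>2 = d\<^sup>2 - h * L * (2 * (j * d)) + h\<^sup>2 * (L\<^sup>2 * j\<^sup>2)"
    unfolding assms(3) h_def by (simp add: power2_eq_square algebra_simps)
  moreover have "- (h * L * (2 * (j * d))) \<le> h * L * s"
    using mult_left_mono[of "- (2 * (j * d))" s "h * L"] ab[of j d] h assms(2) by (simp add: s_def)
  moreover have "h\<^sup>2 * (L\<^sup>2 * j\<^sup>2) \<le> h * (L\<^sup>2 * s)"
    using hh s h by (intro mult_mono) auto
  ultimately have p: "p\<^sup>2 \<le> d\<^sup>2 + h * ((L + L\<^sup>2) * s)" by (simp add: algebra_simps)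
  have "h * ((L + L\<^sup>2) * s) \<le> 1 * ((L + L\<^sup>2) * s)" using h s assms(2) by (intro mult_right_mono) auto
  moreover have "d\<^sup>2 \<le> s" by (simp add: s_def)
  ultimately have ps: "p\<^sup>2 \<le> (1 + L + L\<^sup>2) * s" using p by (simp add: algebra_simps)
  have "q\<^sup>2 = j\<^sup>2 - h * (L + 1) * (2 * (j * p)) + h\<^sup>2 * ((L + 1)\<^sup>2 * p\<^sup>2)"
    unfolding assms(4) h_def by (simp add: power2_eq_square algebra_simps add_divide_distrib)
  moreover have "- (h * (L + 1) * (2 * (j * p))) \<le> h * (L + 1) * (j\<^sup>2 + p\<^sup>2)"
    using mult_left_mono[of "- (2 * (j * p))" "j\<^sup>2 + p\<^sup>2" "h * (L + 1)"] ab[of j p] h assms(2) by simp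
  moreover have "h * (L + 1) * (j\<^sup>2 + p\<^sup>2) \<le> h * (L + 1) * (s + (1 + L + L\<^sup>2) * s)"
    using ps s h assms(2) by (intro mult_left_mono add_mono) auto
  moreover have "h\<^sup>2 * ((L + 1)\<^sup>2 * p\<^sup>2) \<le> h * ((L + 1)\<^sup>2 * ((1 + L + L\<^sup>2) * s))"
    using hh ps h by (intro mult_mono mult_left_mono) auto
  ultimately have q: "q\<^sup>2 \<le> j\<^sup>2 + h * ((L + 1) * (2 + L + L\<^sup>2) + (L + 1)\<^sup>2 * (1 + L + L\<^sup>2)) * s"
    by (simp add: algebra_simps)
  have "p\<^sup>2 + q\<^sup>2 \<le> s + h * \<kappa> * s"
    using p q unfolding \<kappa>_def s_def by (simp add: algebra_simps)
  then show ?thesis by (simp add: s_def h_def algebra_simps)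
qed

text \<open>
  The recurrences rotate \<open>(J\<^sub>l, J\<^sub>l')\<close> into \<open>(J\<^sub>l\<^sub>+\<^sub>1, J\<^sub>l\<^sub>+\<^sub>1')\<close> up to a relative error \<open>O(1/x)\<close>, so that the
  limiting amplitude does not depend on the order.
\<close>

lemma bessel_amplitude:
  "\<exists>K\<ge>0. \<forall>x\<ge>1. x * ((bessel_J l x)\<^sup>2 + (dJ l x)\<^sup>2) \<le> 4 * bessel_energy 0 1 + K / x"
proof (induction l)
  case 0
  show ?case using bessel_0_amplitude(2) by (intro exI[of _ 0]) auto
next
  case (Suc l)
  define C where "C = 4 * bessel_energy 0 1"
  have "C \<ge> 0" using bessel_0_amplitude(1)[of 1] order_trans[OF zero_le_power2] by (fastforce simp: C_def)
  obtain K where K: "K \<ge> 0" "\<And>x. x \<ge> 1 \<Longrightarrow> x * ((bessel_J l x)\<^sup>2 + (dJ l x)\<^sup>2) \<le> C + K / x"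
    using Suc.IH unfolding C_def by blast
  define L where "L = real l"
  define \<kappa> where "\<kappa> = (L + L\<^sup>2) + (L + 1) * (2 + L + L\<^sup>2) + (L + 1)\<^sup>2 * (1 + L + L\<^sup>2)"
  have "\<kappa> \<ge> 0" by (simp add: \<kappa>_def L_def)
  have "x * ((bessel_J (Suc l) x)\<^sup>2 + (dJ (Suc l) x)\<^sup>2) \<le> C + (K + (C + K) * \<kappa>) / x" if x: "x \<ge> 1" for x
  proof -
    define s where "s = (bessel_J l x)\<^sup>2 + (dJ l x)\<^sup>2"
    have "(bessel_J (Suc l) x)\<^sup>2 + (dJ (Suc l) x)\<^sup>2 \<le> s * (1 + \<kappa> / x)"
      unfolding s_def \<kappa>_def
      using dJ_eq[of x l] dJ_Suc_eq[of x l] x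
      by (intro rotation_step_bound) (simp_all add: L_def add.commute)
    then have "x * ((bessel_J (Suc l) x)\<^sup>2 + (dJ (Suc l) x)\<^sup>2) \<le> x * (s * (1 + \<kappa> / x))"
      using x by (intro mult_left_mono) auto
    also have "\<dots> = x * s + (x * s) * (\<kappa> / x)" by (simp add: algebra_simps)
    also have "\<dots> \<le> (C + K / x) + (C + K) * (\<kappa> / x)"
    proof -
      have "K / x \<le> K" using x K(1) by (simp add: divide_le_eq mult_left_le mult_le_cancel_left1)
      then show ?thesis using K(2)[OF x] x \<open>\<kappa> \<ge> 0\<close>
        by (intro add_mono mult_right_mono) (auto simp: s_def)
    qed
    finally show ?thesis by (simp add: add_divide_distrib)
  qed
  then show ?case using K(1) \<open>C \<ge> 0\<close> \<open>\<kappa> \<ge> 0\<close> unfolding C_def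
    by (intro exI[of _ "K + (4 * bessel_energy 0 1 + K) * \<kappa>"]) auto
qed

text \<open>The energy is nondecreasing, so its value at \<open>x\<close> is at most its value at a
  far point, where it is close to x (J_l^2 + J_l'^2). The error there depends on l, but so may the
  far point; the resulting bound does not.\<close>

lemma bessel_energy_le:
  assumes "l > 0" "x > 0"
  shows "bessel_energy l x \<le> 4 * bessel_energy 0 1 + 1"
proof -
  define C where "C = 4 * bessel_energy 0 1"
  obtain K where K: "K \<ge> 0" "\<And>x. x \<ge> 1 \<Longrightarrow> x * ((bessel_J l x)\<^sup>2 + (dJ l x)\<^sup>2) \<le> C + K / x"
    using bessel_amplitude[of l] unfolding C_def by blast
  \<comment> \<open>Chosen so that the total error \<open>(K + \<bar>C\<bar> + K) / y\<close> is at
    most 1: one \<open>K\<close> comes from the amplitude bound, \<open>\<bar>C\<bar> + K\<close>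
    from the lower-order terms of the energy.\<close>
  define y where "y = max (max x 1) (K + \<bar>C\<bar> + K)"
  have y: "y \<ge> x" "y \<ge> 1" "y \<ge> K + \<bar>C\<bar> + K" by (auto simp: y_def)
  define j d where "j = bessel_J l y" and "d = dJ l y"
  have s: "y * (j\<^sup>2 + d\<^sup>2) \<le> C + K / y" using K(2)[OF y(2)] by (simp add: j_def d_def)
  have "2 * (j * d) \<le> j\<^sup>2 + d\<^sup>2" using sum_squares_bound[of j d] by simp
  moreover have "j\<^sup>2 / (2 * y) \<le> j\<^sup>2 / 2" using y by (intro divide_left_mono) auto
  moreover have "(real l)\<^sup>2 / y * j\<^sup>2 \<ge> 0" "d\<^sup>2 \<ge> 0" using y by auto
  ultimately have "bessel_energy l y \<le> y * (j\<^sup>2 + d\<^sup>2) + (j\<^sup>2 + d\<^sup>2)"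
    unfolding bessel_energy_def j_def[symmetric] d_def[symmetric] distrib_left by linarith
  also have "\<dots> = y * (j\<^sup>2 + d\<^sup>2) + y * (j\<^sup>2 + d\<^sup>2) / y" using y by simp
  also have "\<dots> \<le> (C + K / y) + (C + K / y) / y"
    using s y by (intro add_mono divide_right_mono) auto
  also have "\<dots> \<le> C + (K + \<bar>C\<bar> + K) / y"
  proof -
    have "K / y \<le> K" using y K(1) by (simp add: divide_le_eq mult_le_cancel_left1)
    then have "(C + K / y) / y \<le> (\<bar>C\<bar> + K) / y" using y by (intro divide_right_mono) auto
    then show ?thesis by (simp add: add_divide_distrib)
  qed
  also have "\<dots> \<le> C + 1" using y by simp
  finally have "bessel_energy l y \<le> C + 1" .
  with bessel_energy_mono[OF assms y(1)] show ?thesis by (simp add: C_def)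
qed

text \<open>In the range 2l \<le> x the coefficient x^2 - l^2 + 1/4 is at least x^2/2, so the energy
  bound 4B + 1 yields x J_l^2 \<le> 2 (4B + 1), whence the constant.\<close>

theorem bessel_J_squared_bound:
  obtains C where "C > 0" "\<And>l x. x \<ge> 1 \<Longrightarrow> 2 * real l \<le> x \<Longrightarrow> (bessel_J l x)\<^sup>2 \<le> C / x"
proof
  define B where "B = bessel_energy 0 1"
  have B: "B \<ge> 0" using bessel_0_amplitude(1)[of 1] order_trans[OF zero_le_power2] by (fastforce simp: B_def)
  show "8 * B + 2 > 0" using B by simp
  fix l :: nat and x :: real assume x: "x \<ge> 1" "2 * real l \<le> x"
  show "(bessel_J l x)\<^sup>2 \<le> (8 * B + 2) / x"
  proof (cases "l = 0")
    case True
    then show ?thesis using bessel_0_amplitude(1)[OF x(1)] x B by (simp add: B_def field_simps)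
  next
    case False
    define j where "j = bessel_J l x"
    have "(real l)\<^sup>2 \<le> (x / 2)\<^sup>2" using x by (intro power_mono) auto
    moreover have "(x / 2)\<^sup>2 = x\<^sup>2 / 4" "x\<^sup>2 \<ge> 0" by (simp_all add: power_divide)
    ultimately have "x\<^sup>2 / 2 \<le> x\<^sup>2 - (real l)\<^sup>2 + 1/4" by linarith
    then have "x\<^sup>2 / 2 * j\<^sup>2 \<le> (x\<^sup>2 - (real l)\<^sup>2 + 1/4) * j\<^sup>2" by (intro mult_right_mono) auto
    also have "\<dots> \<le> x * bessel_energy l x"
      using bessel_energy_square[of x l] x by (simp add: j_def)
    also have "\<dots> \<le> x * (4 * B + 1)"
      using bessel_energy_le[of l x] False x unfolding B_def by (intro mult_left_mono) auto
    finally have "x * (x * j\<^sup>2) \<le> x * (8 * B + 2)" by (simp add: power2_eq_square algebra_simps)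
    then have "x * j\<^sup>2 \<le> 8 * B + 2" using x by simp
    then show ?thesis using x by (simp add: j_def field_simps)
  qed
qed

section \<open>Moments of the squares\<close>

definition bessel_sum :: "(nat \<Rightarrow> real) \<Rightarrow> real \<Rightarrow> real" where
  "bessel_sum w r = (\<Sum>n. w (Suc n) * (bessel_J (Suc n) r)\<^sup>2)"

lemma summable_bessel_sum:
  "subexp w \<Longrightarrow> r > 0 \<Longrightarrow> summable (\<lambda>n. w (Suc n) * (bessel_J (Suc n) r)\<^sup>2)"
  using summable_weighted[OF _ geo_dom_bessel_products(1)] by simp

lemma bessel_sum_sums:
  "subexp w \<Longrightarrow> r > 0 \<Longrightarrow> (\<lambda>n. w (Suc n) * (bessel_J (Suc n) r)\<^sup>2) sums bessel_sum w r"
  unfolding bessel_sum_def by (rule summable_sums) (rule summable_bessel_sum)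

lemma subexpI:
  assumes "\<And>n. \<bar>w n\<bar> \<le> C * 2 ^ n" shows "subexp w"
  unfolding subexp_def by (rule BseqI'[of _ C]) (use assms in \<open>simp add: field_simps\<close>)

lemma subexp_add:
  assumes "subexp v" "subexp w" shows "subexp (\<lambda>n. v n + w n)"
proof -
  obtain C where C: "\<And>n. \<bar>v n\<bar> \<le> C * 2 ^ n" using subexpE[OF assms(1)] by metis
  obtain D where D: "\<And>n. \<bar>w n\<bar> \<le> D * 2 ^ n" using subexpE[OF assms(2)] by metis
  have "\<bar>v n + w n\<bar> \<le> (C + D) * 2 ^ n" for n
    using C[of n] D[of n] by (simp add: distrib_right)
  then show ?thesis by (rule subexpI)
qed

lemma subexp_cmult:
  assumes "subexp w" shows "subexp (\<lambda>n. c * w n)"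
proof -
  obtain C where C: "\<And>n. \<bar>w n\<bar> \<le> C * 2 ^ n" using subexpE[OF assms] by metis
  have "\<bar>c * w n\<bar> \<le> (\<bar>c\<bar> * C) * 2 ^ n" for n
    using mult_left_mono[OF C[of n], of "\<bar>c\<bar>"] by (simp add: abs_mult mult.assoc)
  then show ?thesis by (rule subexpI)
qed

lemma subexp_truncate: "subexp (\<lambda>n. if n < N then f n else 0)"
proof -
  have "\<forall>\<^sub>F n in sequentially. (if n < N then f n else 0) / 2 ^ n = 0"
    using eventually_ge_at_top[of N] by eventually_elim simp
  then have "(\<lambda>n. (if n < N then f n else 0) / 2 ^ n) \<longlonglongrightarrow> 0" by (rule tendsto_eventually)
  then show ?thesis unfolding subexp_def by (intro convergent_imp_Bseq convergentI)
qed

lemma subexp_abs: "subexp w \<Longrightarrow> subexp (\<lambda>n. \<bar>w n\<bar>)"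
  unfolding subexp_def by (simp add: Bseq_def)

lemma subexp_powr_asymp:
  assumes "(\<lambda>n. w n / real n powr \<alpha>) \<longlonglongrightarrow> W"
  shows "subexp w"
proof -
  have "(\<lambda>n. real n powr \<alpha> / 2 ^ n) \<longlonglongrightarrow> 0" by real_asymp
  from tendsto_mult[OF assms this]
  have "(\<lambda>n. (w n / real n powr \<alpha>) * (real n powr \<alpha> / 2 ^ n)) \<longlonglongrightarrow> 0" by simp
  moreover have "\<forall>\<^sub>F n in sequentially. (w n / real n powr \<alpha>) * (real n powr \<alpha> / 2 ^ n) = w n / 2 ^ n"
    using eventually_gt_at_top[of 0] by eventually_elim simp
  ultimately have "(\<lambda>n. w n / 2 ^ n) \<longlonglongrightarrow> 0" by (rule Lim_transform_eventually)
  then show ?thesis unfolding subexp_def by (intro convergent_imp_Bseq convergentI)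
qed

lemma subexp_powr: "subexp (\<lambda>n. real n powr \<alpha>)"
proof (rule subexp_powr_asymp)
  show "(\<lambda>n. real n powr \<alpha> / real n powr \<alpha>) \<longlonglongrightarrow> 1"
    by (rule tendsto_eventually) (use eventually_gt_at_top[of 0] in eventually_elim, simp)
qed

lemma bessel_sum_add:
  assumes "subexp v" "subexp w" "r > 0"
  shows "bessel_sum (\<lambda>n. v n + w n) r = bessel_sum v r + bessel_sum w r"
  using sums_unique[OF sums_add[OF bessel_sum_sums[OF assms(1,3)] bessel_sum_sums[OF assms(2,3)]]]
  by (simp add: bessel_sum_def distrib_right)

lemma bessel_sum_cmult:
  assumes "subexp w" "r > 0"
  shows "bessel_sum (\<lambda>n. c * w n) r = c * bessel_sum w r"
  using sums_unique[OF sums_mult[OF bessel_sum_sums[OF assms], of c]]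
  by (simp add: bessel_sum_def mult.assoc)

lemma abs_bessel_sum_le:
  assumes "subexp v" "subexp w" "r > 0" "\<And>n. n > 0 \<Longrightarrow> \<bar>v n\<bar> \<le> w n"
  shows "\<bar>bessel_sum v r\<bar> \<le> bessel_sum w r"
proof -
  have "norm (bessel_sum v r) \<le> bessel_sum w r"
    unfolding bessel_sum_def
    by (rule norm_suminf_le[OF _ summable_bessel_sum[OF assms(2,3)]])
       (simp add: abs_mult mult_right_mono assms(4))
  then show ?thesis by simp
qed

lemma bessel_sum_cong: "(\<And>n. n > 0 \<Longrightarrow> v n = w n) \<Longrightarrow> bessel_sum v r = bessel_sum w r"
  unfolding bessel_sum_def by simp

text \<open>For a fixed order J_l^2 = O(1/r), and 1/r = o(r^\<alpha>) precisely when \<alpha> > -1.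
  Hence boundary terms and any finite set of orders are negligible.\<close>

lemma bessel_J_squared_over_powr:
  assumes "\<alpha> > -1"
  shows "((\<lambda>r. (bessel_J l r)\<^sup>2 / r powr \<alpha>) \<longlongrightarrow> 0) at_top"
proof -
  obtain C where C: "C > 0" "\<And>l x. x \<ge> 1 \<Longrightarrow> 2 * real l \<le> x \<Longrightarrow> (bessel_J l x)\<^sup>2 \<le> C / x"
    using bessel_J_squared_bound by metis
  have "((\<lambda>r. C * r powr (-1 - \<alpha>)) \<longlongrightarrow> C * 0) at_top"
    using assms by (intro tendsto_mult_left tendsto_neg_powr filterlim_ident) auto
  then have "((\<lambda>r. C * r powr (-1 - \<alpha>)) \<longlongrightarrow> 0) at_top" by simp
  moreover have "\<forall>\<^sub>F r in at_top. norm ((bessel_J l r)\<^sup>2 / r powr \<alpha>) \<le> C * r powr (-1 - \<alpha>)"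
    using eventually_ge_at_top[of "max 1 (2 * real l)"]
  proof eventually_elim
    case (elim r)
    have "C * r powr (-1 - \<alpha>) = C / r / r powr \<alpha>"
      using elim by (simp add: powr_diff powr_minus divide_inverse)
    moreover have "(bessel_J l r)\<^sup>2 / r powr \<alpha> \<le> C / r / r powr \<alpha>"
      using C(2)[of r l] elim by (intro divide_right_mono) auto
    ultimately show ?case by simp
  qed
  ultimately show ?thesis by (rule Lim_null_comparison[rotated])
qed

text \<open>The difference of the weights is o(n^\<alpha>): beyond some order it is at most
  \<epsilon> n^\<alpha>, and the finitely many orders before that contribute o(r^\<alpha>). Only the
  asymptotics of a weight matter from here on.\<close>

lemma bessel_sum_asymp_transfer:
  assumes "\<alpha> > -1" and w: "(\<lambda>n. w n / real n powr \<alpha>) \<longlonglongrightarrow> W"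
    and L: "((\<lambda>r. bessel_sum (\<lambda>n. real n powr \<alpha>) r / r powr \<alpha>) \<longlongrightarrow> L) at_top"
  shows "((\<lambda>r. bessel_sum w r / r powr \<alpha>) \<longlongrightarrow> W * L) at_top"
proof -
  define d where "d n = w n + (- W) * real n powr \<alpha>" for n
  have sw: "subexp w" by (rule subexp_powr_asymp[OF w])
  have sW: "subexp (\<lambda>n. (- W) * real n powr \<alpha>)" by (intro subexp_cmult subexp_powr)
  have sd: "subexp d" unfolding d_def by (intro subexp_add sw sW)
  have d: "(\<lambda>n. d n / real n powr \<alpha>) \<longlonglongrightarrow> 0"
  proof -
    have "(\<lambda>n. w n / real n powr \<alpha> - W) \<longlonglongrightarrow> W - W" by (intro tendsto_diff w tendsto_const)
    moreover have "\<forall>\<^sub>F n in sequentially. w n / real n powr \<alpha> - W = d n / real n powr \<alpha>"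
      using eventually_gt_at_top[of 0] by eventually_elim (simp add: d_def field_simps)
    ultimately show ?thesis by (simp add: Lim_transform_eventually)
  qed
  have "((\<lambda>r. bessel_sum d r / r powr \<alpha>) \<longlongrightarrow> 0) at_top"
  proof (rule tendstoI)
    fix e :: real assume e: "e > 0"
    \<comment> \<open>Makes \<open>\<epsilon> * L\<close> at most \<open>e / 2\<close>; the added 1
      keeps the denominator positive when \<open>L = 0\<close>.\<close>
    define \<epsilon> where "\<epsilon> = e / (2 * (\<bar>L\<bar> + 1))"
    have \<epsilon>: "\<epsilon> > 0" "\<epsilon> * L < e"
    proof -
      show "\<epsilon> > 0" using e by (simp add: \<epsilon>_def)
      have "\<epsilon> * L \<le> \<epsilon> * (\<bar>L\<bar> + 1)" using \<open>\<epsilon> > 0\<close> by (intro mult_left_mono) auto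
      also have "\<dots> = e / 2" by (simp add: \<epsilon>_def field_simps)
      finally show "\<epsilon> * L < e" using e by simp
    qed
    obtain N where N: "\<And>n. n \<ge> N \<Longrightarrow> \<bar>d n / real n powr \<alpha>\<bar> < \<epsilon>"
      using tendstoD[OF d \<epsilon>(1)] by (auto simp: eventually_sequentially)
    \<comment> \<open>Cutting at \<open>Suc N\<close> keeps the orders 1 to \<open>N\<close>, that
      is, the first \<open>N\<close> terms of the series.\<close>
    define v where "v n = (if n < Suc N then \<bar>d n\<bar> else 0)" for n
    have sv: "subexp v"
      unfolding v_def[abs_def] by (rule subexp_truncate)
    have v_eq: "bessel_sum v r = (\<Sum>n<N. \<bar>d (Suc n)\<bar> * (bessel_J (Suc n) r)\<^sup>2)" for r
      unfolding bessel_sum_def by (subst suminf_finite[of "{..<N}"]) (auto simp: v_def)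
    have "((\<lambda>r. \<epsilon> * (bessel_sum (\<lambda>n. real n powr \<alpha>) r / r powr \<alpha>)
        + (\<Sum>n<N. \<bar>d (Suc n)\<bar> * ((bessel_J (Suc n) r)\<^sup>2 / r powr \<alpha>))) \<longlongrightarrow> \<epsilon> * L + (\<Sum>n<N. \<bar>d (Suc n)\<bar> * 0)) at_top"
      by (intro tendsto_add tendsto_mult_left tendsto_sum L bessel_J_squared_over_powr assms(1))
    then have "\<forall>\<^sub>F r in at_top. \<epsilon> * (bessel_sum (\<lambda>n. real n powr \<alpha>) r / r powr \<alpha>)
        + (\<Sum>n<N. \<bar>d (Suc n)\<bar> * ((bessel_J (Suc n) r)\<^sup>2 / r powr \<alpha>)) < e"
      using \<epsilon>(2) by (intro order_tendstoD(2)) auto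
    then show "\<forall>\<^sub>F r in at_top. dist (bessel_sum d r / r powr \<alpha>) 0 < e"
      using eventually_gt_at_top[of 0]
    proof eventually_elim
      case (elim r)
      have "\<bar>d n\<bar> \<le> \<epsilon> * real n powr \<alpha> + v n" if "n > 0" for n
      proof (cases "n < Suc N")
        case True
        then show ?thesis using \<epsilon>(1) by (simp add: v_def)
      next
        case False
        then have "\<bar>d n\<bar> / real n powr \<alpha> < \<epsilon>" using N[of n] by (simp add: abs_divide)
        then show ?thesis using that \<epsilon>(1) False by (simp add: v_def divide_less_eq)
      qed
      then have "\<bar>bessel_sum d r\<bar> \<le> bessel_sum (\<lambda>n. \<epsilon> * real n powr \<alpha> + v n) r"
        using elim by (intro abs_bessel_sum_le sd subexp_add subexp_cmult subexp_powr sv) auto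
      also have "\<dots> = \<epsilon> * bessel_sum (\<lambda>n. real n powr \<alpha>) r + bessel_sum v r"
        using elim by (simp add: bessel_sum_add bessel_sum_cmult subexp_cmult subexp_powr sv)
      finally have "\<bar>bessel_sum d r\<bar> / r powr \<alpha>
          \<le> (\<epsilon> * bessel_sum (\<lambda>n. real n powr \<alpha>) r + bessel_sum v r) / r powr \<alpha>"
        by (intro divide_right_mono) auto
      also have "\<dots> < e" using elim(1) unfolding v_eq by (simp add: add_divide_distrib sum_divide_distrib)
      finally show ?case by (simp add: abs_divide)
    qed
  qed
  then have "((\<lambda>r. bessel_sum d r / r powr \<alpha> + W * (bessel_sum (\<lambda>n. real n powr \<alpha>) r / r powr \<alpha>))
      \<longlongrightarrow> 0 + W * L) at_top"
    by (intro tendsto_add tendsto_mult_left L)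
  moreover have "\<forall>\<^sub>F r in at_top. bessel_sum d r / r powr \<alpha> + W * (bessel_sum (\<lambda>n. real n powr \<alpha>) r / r powr \<alpha>)
      = bessel_sum w r / r powr \<alpha>"
    using eventually_gt_at_top[of 0]
  proof eventually_elim
    case (elim r)
    have "bessel_sum d r = bessel_sum w r + (- W) * bessel_sum (\<lambda>n. real n powr \<alpha>) r"
      unfolding d_def bessel_sum_add[OF sw sW elim] bessel_sum_cmult[OF subexp_powr elim] ..
    then show ?case by (simp add: diff_divide_distrib)
  qed
  ultimately show ?thesis by (simp add: Lim_transform_eventually)
qed

text \<open>Reindexing moves the shift from the Bessel function to the weight. The price is a
  boundary term, at order 0 here and at order 1 for the opposite shift.\<close>

lemma bessel_sum_shift_down:
  assumes "subexp (\<lambda>n. w (Suc n))" "r > 0"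
  shows "(\<lambda>n. w (Suc n) * (bessel_J n r)\<^sup>2) sums (bessel_sum (\<lambda>n. w (Suc n)) r + w 1 * (bessel_J 0 r)\<^sup>2)"
  using bessel_sum_sums[OF assms] sums_Suc_iff[of "\<lambda>n. w (Suc n) * (bessel_J n r)\<^sup>2"] by simp

lemma bessel_sum_shift_up:
  assumes "subexp (\<lambda>n. w (n - 1))" "r > 0"
  shows "(\<lambda>n. w (Suc n) * (bessel_J (Suc (Suc n)) r)\<^sup>2) sums
    (bessel_sum (\<lambda>n. w (n - 1)) r - w 0 * (bessel_J 1 r)\<^sup>2)"
  using bessel_sum_sums[OF assms] sums_Suc_iff[of "\<lambda>n. w n * (bessel_J (Suc n) r)\<^sup>2"] by simp

lemma DERIV_bessel_sum:
  assumes "subexp w" "r > 0"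
  shows "(bessel_sum w has_real_derivative 2 * (\<Sum>n. w (Suc n) * (bessel_J (Suc n) r * dJ (Suc n) r))) (at r)"
proof -
  have "((\<lambda>x. \<Sum>n. w (Suc n) * (bessel_J (Suc n) x)\<^sup>2) has_real_derivative
      (\<Sum>n. w (Suc n) * (2 * (bessel_J (Suc n) r * dJ (Suc n) r)))) (at r)"
  proof (rule DERIV_weighted[OF assms(1) geo_dom_bessel_products(1) _ assms(2)])
    show "geo_dom (1/4) (\<lambda>l x. 2 * (bessel_J l x * dJ l x))"
      by (intro geo_dom_cmult geo_dom_bessel_products) auto
    show "((\<lambda>x. (bessel_J l x)\<^sup>2) has_real_derivative 2 * (bessel_J l x * dJ l x)) (at x)"
      if "x > 0" for l x
      using that by (auto intro!: derivative_eq_intros DERIV_bessel_J)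
  qed
  moreover have "(\<Sum>n. w (Suc n) * (2 * (bessel_J (Suc n) r * dJ (Suc n) r)))
      = 2 * (\<Sum>n. w (Suc n) * (bessel_J (Suc n) r * dJ (Suc n) r))"
    unfolding suminf_mult[OF summable_weighted[OF assms(1) geo_dom_bessel_products(2) assms(2)], symmetric]
    by (simp only: mult.left_commute)
  ultimately show ?thesis unfolding bessel_sum_def[abs_def] by simp
qed

section \<open>Arcsine moments and the even moments of the squares\<close>

text \<open>The substitution u = s^2 turns the integral of s^\<alpha> / (\<pi> sqrt (1 - s^2)) over
  [0, 1] into this Beta value. The total mass is 1/2, the other half belonging to negative
  orders.\<close>

definition arcsine_moment :: "real \<Rightarrow> real" where
  "arcsine_moment \<alpha> = Beta ((\<alpha> + 1) / 2) (1 / 2) / (2 * pi)"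

lemma arcsine_moment_0: "arcsine_moment 0 = 1 / 2"
  by (simp add: arcsine_moment_def Beta_def Gamma_one_half_real)

text \<open>The recursion of the Beta function in its first argument. At \<alpha> = 2k the factor
  agrees with the one that l'Hopital's rule produces for the Bessel sums.\<close>

lemma arcsine_moment_add_2:
  assumes "\<alpha> > -1"
  shows "arcsine_moment (\<alpha> + 2) = (\<alpha> + 1) / (\<alpha> + 2) * arcsine_moment \<alpha>"
proof -
  define x where "x = (\<alpha> + 1) / 2"
  have "x > 0" using assms by (simp add: x_def)
  then have "(x + 1/2) * Beta (x + 1) (1/2) = x * Beta x (1/2)"
    by (intro Beta_plus1_left) (auto dest: nonpos_Ints_nonpos)
  then have "Beta (x + 1) (1/2) = x / (x + 1/2) * Beta x (1/2)" using \<open>x > 0\<close> by (simp add: field_simps)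
  moreover have e: "(\<alpha> + 2 + 1) / 2 = x + 1" "x / (x + 1/2) = (\<alpha> + 1) / (\<alpha> + 2)"
    using assms by (simp_all add: x_def field_simps)
  ultimately show ?thesis unfolding arcsine_moment_def x_def[symmetric] e(1) by (simp only: e(2) times_divide_eq_right)
qed

text \<open>After division by n^(m+1) the numerator becomes a sum of two increments of t^(m+1) at t
  = 1, with steps 1/n and -1/n; each difference quotient tends to m + 1.\<close>

lemma central_difference_power_asymp:
  "(\<lambda>n. (real (Suc n) ^ Suc m - real (n - 1) ^ Suc m) / real n ^ m) \<longlonglongrightarrow> 2 * real (Suc m)"
proof -
  have D: "((\<lambda>h. ((1 + h) ^ Suc m - 1 ^ Suc m) / h) \<longlongrightarrow> real (Suc m)) (at (0::real))"
    using DERIV_power[OF DERIV_ident[of "at (1::real)"], of "Suc m"] by (simp add: DERIV_def del: power_Suc)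
  have h1: "filterlim (\<lambda>n. 1 / real n) (at 0) sequentially"
    unfolding filterlim_at using eventually_gt_at_top[of 0]
    by (auto intro: lim_1_over_n elim: eventually_mono)
  have h2: "filterlim (\<lambda>n. - (1 / real n)) (at 0) sequentially"
    unfolding filterlim_at using eventually_gt_at_top[of 0] tendsto_minus[OF lim_1_over_n]
    by (auto elim: eventually_mono)
  have "(\<lambda>n. ((1 + 1 / real n) ^ Suc m - 1 ^ Suc m) / (1 / real n)
      + ((1 + - (1 / real n)) ^ Suc m - 1 ^ Suc m) / (- (1 / real n))) \<longlonglongrightarrow> real (Suc m) + real (Suc m)"
    by (intro tendsto_add filterlim_compose[OF D h1] filterlim_compose[OF D h2])
  moreover have "\<forall>\<^sub>F n in sequentially. ((1 + 1 / real n) ^ Suc m - 1 ^ Suc m) / (1 / real n)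
      + ((1 + - (1 / real n)) ^ Suc m - 1 ^ Suc m) / (- (1 / real n))
      = (real (Suc n) ^ Suc m - real (n - 1) ^ Suc m) / real n ^ m"
    using eventually_gt_at_top[of 0]
  proof eventually_elim
    case (elim n)
    have "1 + 1 / real n = real (Suc n) / real n" "1 + - (1 / real n) = real (n - 1) / real n"
      using elim by (simp_all add: field_simps of_nat_diff)
    moreover have "((a / x) ^ Suc m - 1 ^ Suc m) / (1 / x) + ((b / x) ^ Suc m - 1 ^ Suc m) / (- (1 / x))
        = (a ^ Suc m - b ^ Suc m) / x ^ m" if "x > 0" for a b x :: real
      using that by (simp add: power_divide field_simps)
    ultimately show ?case using elim by (simp only: of_nat_0_less_iff)
  qed
  ultimately show ?thesis by (simp add: Lim_transform_eventually)
qed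

text \<open>The left side is the derivative of the moment of order \<open>2 * k + 2\<close>. One
  factor l/r is spent on the telescoping identity, and summation by parts differences the remaining
  power. Its exponent is odd, hence positive: 0^p = 0 removes the J_1 term and 1^p = 1 leaves
  J_0^2.\<close>

lemma suminf_power_bessel_J_dJ:
  assumes "r > 0"
  shows "2 * (\<Sum>n. real (Suc n) ^ (2 * k + 2) * (bessel_J (Suc n) r * dJ (Suc n) r))
    = r / 2 * (bessel_sum (\<lambda>n. real (Suc n) ^ (2 * k + 1) - real (n - 1) ^ (2 * k + 1)) r + (bessel_J 0 r)\<^sup>2)"
proof -
  define p where "p = 2 * k + 1"
  have s: "subexp (\<lambda>n. real (Suc n) ^ p)" "subexp (\<lambda>n. real (n - 1) ^ p)"
  proof -
    have "(\<lambda>n. real (Suc n) ^ p / real n powr real p) \<longlonglongrightarrow> 1"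
    proof -
      have "(\<lambda>n. (real (Suc n) / real n) ^ p) \<longlonglongrightarrow> 1 ^ p" by (intro tendsto_power) real_asymp
      moreover have "\<forall>\<^sub>F n in sequentially. (real (Suc n) / real n) ^ p = real (Suc n) ^ p / real n powr real p"
        using eventually_gt_at_top[of 0]
        by eventually_elim (simp add: power_divide powr_realpow del: of_nat_Suc)
      ultimately show ?thesis by (simp add: Lim_transform_eventually)
    qed
    then show "subexp (\<lambda>n. real (Suc n) ^ p)" by (rule subexp_powr_asymp)
    have "(\<lambda>n. real (n - 1) ^ p / real n powr real p) \<longlonglongrightarrow> 1"
    proof -
      have "(\<lambda>n. ((real n - 1) / real n) ^ p) \<longlonglongrightarrow> 1 ^ p" by (intro tendsto_power) real_asymp
      moreover have "\<forall>\<^sub>F n in sequentially. ((real n - 1) / real n) ^ p = real (n - 1) ^ p / real n powr real p"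
        using eventually_gt_at_top[of 0]
        by eventually_elim (simp add: power_divide powr_realpow of_nat_diff)
      ultimately show ?thesis by (simp add: Lim_transform_eventually)
    qed
    then show "subexp (\<lambda>n. real (n - 1) ^ p)" by (rule subexp_powr_asymp)
  qed
  have "(\<lambda>n. real (Suc n) ^ p * (bessel_J n r)\<^sup>2 - real (Suc n) ^ p * (bessel_J (Suc (Suc n)) r)\<^sup>2) sums
      ((bessel_sum (\<lambda>n. real (Suc n) ^ p) r + real 1 ^ p * (bessel_J 0 r)\<^sup>2)
      - (bessel_sum (\<lambda>n. real (n - 1) ^ p) r - real 0 ^ p * (bessel_J 1 r)\<^sup>2))"
    by (intro sums_diff bessel_sum_shift_down[of "\<lambda>n. real n ^ p"] bessel_sum_shift_up[of "\<lambda>n. real n ^ p"] s assms)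
  moreover have "bessel_sum (\<lambda>n. real (Suc n) ^ p + (-1) * real (n - 1) ^ p) r
      = bessel_sum (\<lambda>n. real (Suc n) ^ p) r + (-1) * bessel_sum (\<lambda>n. real (n - 1) ^ p) r"
    using s assms by (simp only: bessel_sum_add bessel_sum_cmult subexp_cmult)
  then have "(bessel_sum (\<lambda>n. real (Suc n) ^ p) r + real 1 ^ p * (bessel_J 0 r)\<^sup>2)
      - (bessel_sum (\<lambda>n. real (n - 1) ^ p) r - real 0 ^ p * (bessel_J 1 r)\<^sup>2)
      = bessel_sum (\<lambda>n. real (Suc n) ^ p - real (n - 1) ^ p) r + (bessel_J 0 r)\<^sup>2"
    by (simp add: p_def)
  ultimately have *: "(\<lambda>n. real (Suc n) ^ p * (bessel_J n r)\<^sup>2 - real (Suc n) ^ p * (bessel_J (Suc (Suc n)) r)\<^sup>2) sums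
      (bessel_sum (\<lambda>n. real (Suc n) ^ p - real (n - 1) ^ p) r + (bessel_J 0 r)\<^sup>2)"
    by (simp only:)
  have "2 * (real (Suc n) ^ (2 * k + 2) * (bessel_J (Suc n) r * dJ (Suc n) r))
      = r / 2 * (real (Suc n) ^ p * (bessel_J n r)\<^sup>2 - real (Suc n) ^ p * (bessel_J (Suc (Suc n)) r)\<^sup>2)" for n
  proof -
    have "2 * (real (Suc n) ^ (2 * k + 2) * (bessel_J (Suc n) r * dJ (Suc n) r))
        = 2 * r * real (Suc n) ^ p * (real (Suc n) / r * (bessel_J (Suc n) r * dJ (Suc n) r))"
      using assms by (simp add: p_def del: of_nat_Suc)
    then show ?thesis
      using assms unfolding bessel_J_times_dJ(1)[OF less_imp_neq[OF assms, symmetric]]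
      by (simp add: algebra_simps del: of_nat_Suc)
  qed
  with sums_mult[OF *, of "r / 2"]
  have "(\<lambda>n. 2 * (real (Suc n) ^ (2 * k + 2) * (bessel_J (Suc n) r * dJ (Suc n) r))) sums
    (r / 2 * (bessel_sum (\<lambda>n. real (Suc n) ^ p - real (n - 1) ^ p) r + (bessel_J 0 r)\<^sup>2))"
    by (simp only:)
  then have **: "(\<lambda>n. (1/2) * (2 * (real (Suc n) ^ (2 * k + 2) * (bessel_J (Suc n) r * dJ (Suc n) r)))) sums
    ((1/2) * (r / 2 * (bessel_sum (\<lambda>n. real (Suc n) ^ p - real (n - 1) ^ p) r + (bessel_J 0 r)\<^sup>2)))"
    by (rule sums_mult)
  show ?thesis using sums_unique[OF **] unfolding p_def by simp
qed

theorem bessel_sum_even_moments: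
  "((\<lambda>r. bessel_sum (\<lambda>n. real n powr (2 * real k)) r / r powr (2 * real k)) \<longlongrightarrow> arcsine_moment (2 * real k)) at_top"
proof (induction k)
  case 0
  have "((\<lambda>r. (1 - (bessel_J 0 r)\<^sup>2 / r powr 0) / 2) \<longlongrightarrow> (1 - 0) / 2) at_top"
    by (intro tendsto_divide tendsto_diff tendsto_const bessel_J_squared_over_powr) auto
  moreover have "\<forall>\<^sub>F r in at_top. (1 - (bessel_J 0 r)\<^sup>2 / r powr 0) / 2
      = bessel_sum (\<lambda>n. real n powr (2 * real 0)) r / r powr (2 * real 0)"
    using eventually_gt_at_top[of 0]
    by eventually_elim (simp add: bessel_sum_def bessel_J_sum_squares)
  ultimately show ?case by (simp add: Lim_transform_eventually arcsine_moment_0)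
next
  case (Suc k)
  define m where "m = arcsine_moment (2 * real k)"
  define v where "v n = real (Suc n) ^ (2 * k + 1) - real (n - 1) ^ (2 * k + 1)" for n
  define S where "S = bessel_sum (\<lambda>n. real n ^ (2 * k + 2))"
  define S' where "S' r = r / 2 * (bessel_sum v r + (bessel_J 0 r)\<^sup>2)" for r
  have "(\<lambda>n. v n / real n ^ (2 * k)) \<longlonglongrightarrow> 2 * real (2 * k + 1)"
    using central_difference_power_asymp[of "2 * k"] by (simp add: v_def)
  moreover have "\<forall>\<^sub>F n in sequentially. v n / real n ^ (2 * k) = v n / real n powr (2 * real k)"
    using eventually_gt_at_top[of 0]
    by eventually_elim (simp flip: powr_realpow)
  ultimately have "(\<lambda>n. v n / real n powr (2 * real k)) \<longlonglongrightarrow> 2 * real (2 * k + 1)"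
    by (rule Lim_transform_eventually)
  \<comment> \<open>The induction hypothesis concerns \<open>n ^ (2 * k)\<close>; the transfer
    carries it over to the central difference, whose lower powers need no separate
    treatment.\<close>
  from bessel_sum_asymp_transfer[OF _ this Suc.IH]
  have v: "((\<lambda>r. bessel_sum v r / r powr (2 * real k)) \<longlongrightarrow> 2 * real (2 * k + 1) * m) at_top"
    by (simp add: m_def)
  have "((\<lambda>r. (bessel_sum v r / r powr (2 * real k) + (bessel_J 0 r)\<^sup>2 / r powr (2 * real k)) / (2 * real (2 * k + 2)))
      \<longlongrightarrow> (2 * real (2 * k + 1) * m + 0) / (2 * real (2 * k + 2))) at_top"
    by (intro tendsto_divide tendsto_add v bessel_J_squared_over_powr tendsto_const) auto
  moreover have "\<forall>\<^sub>F r in at_top. (bessel_sum v r / r powr (2 * real k) + (bessel_J 0 r)\<^sup>2 / r powr (2 * real k)) / (2 * real (2 * k + 2))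
      = S' r / (real (2 * k + 2) * r ^ (2 * k + 1))"
    using eventually_gt_at_top[of 0]
  proof eventually_elim
    case (elim r)
    have "r powr (2 * real k) = r ^ (2 * k)" using powr_realpow[OF elim, of "2 * k"] by simp
    then show ?case using elim
      by (simp add: S'_def add_divide_distrib[symmetric] del: of_nat_add of_nat_mult) 
  qed
  ultimately have lim: "((\<lambda>r. S' r / (real (2 * k + 2) * r ^ (2 * k + 1)))
      \<longlongrightarrow> (2 * real (2 * k + 1) * m + 0) / (2 * real (2 * k + 2))) at_top"
    by (rule Lim_transform_eventually)
  \<comment> \<open>This form of l'Hopital's rule asks only that the denominator tend to infinity,
    so nothing has to be known about the growth of \<open>S\<close>.\<close>
  have "((\<lambda>r. S r / r ^ (2 * k + 2)) \<longlongrightarrow> (2 * real (2 * k + 1) * m + 0) / (2 * real (2 * k + 2))) at_top"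
  proof (rule lhospital_at_top_at_top[OF _ _ _ _ lim])
    show "filterlim (\<lambda>r. r ^ (2 * k + 2) :: real) at_top at_top"
      by (intro filterlim_pow_at_top filterlim_ident) auto
    show "\<forall>\<^sub>F r in at_top. real (2 * k + 2) * r ^ (2 * k + 1) \<noteq> 0"
      using eventually_gt_at_top[of 0] by eventually_elim simp
    show "\<forall>\<^sub>F r in at_top. (S has_real_derivative S' r) (at r)"
      using eventually_gt_at_top[of 0]
    proof eventually_elim
      case (elim r)
      have "subexp (\<lambda>n. real n ^ (2 * k + 2))"
      proof (rule subexp_powr_asymp)
        show "(\<lambda>n. real n ^ (2 * k + 2) / real n powr real (2 * k + 2)) \<longlonglongrightarrow> 1"
          by (rule tendsto_eventually)
             (use eventually_gt_at_top[of 0] in eventually_elim, subst powr_realpow, auto)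
      qed
      from DERIV_bessel_sum[OF this elim] show ?case
        unfolding S_def S'_def v_def suminf_power_bessel_J_dJ[OF elim, of k] .
    qed
    show "\<forall>\<^sub>F r in at_top. ((\<lambda>r. r ^ (2 * k + 2)) has_real_derivative real (2 * k + 2) * r ^ (2 * k + 1)) (at r)"
      using DERIV_pow[of "2 * k + 2"] by (intro always_eventually allI) simp
  qed
  moreover have "\<forall>\<^sub>F r in at_top. S r / r ^ (2 * k + 2)
      = bessel_sum (\<lambda>n. real n powr (2 * real (Suc k))) r / r powr (2 * real (Suc k))"
    using eventually_gt_at_top[of 0]
  proof eventually_elim
    case (elim r)
    have p: "x powr (2 * real (Suc k)) = x ^ (2 * k + 2)" if "x > 0" for x :: real
      using powr_realpow[OF that, of "2 * k + 2"] by (simp add: algebra_simps)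
    have "S r = bessel_sum (\<lambda>n. real n powr (2 * real (Suc k))) r"
      unfolding S_def by (rule bessel_sum_cong) (subst p, auto)
    then show ?case using p[OF elim] by simp
  qed
  moreover have "(2 * real (2 * k + 1) * m + 0) / (2 * real (2 * k + 2)) = arcsine_moment (2 * real (Suc k))"
  proof -
    have "arcsine_moment (2 * real k + 2) = (2 * real k + 1) / (2 * real k + 2) * m"
      unfolding m_def by (rule arcsine_moment_add_2) simp
    then show ?thesis by (simp add: field_simps)
  qed
  ultimately show ?case by (simp add: Lim_transform_eventually)
qed

section \<open>Polynomial approximation and moments of real order\<close>

text \<open>Weierstrass is applied on [0, 2] to u^a made constant below \<delta>. Below \<delta> the
  error of this change is paid by the more singular u^b, and beyond 2, where the polynomial is
  uncontrolled, by a sufficiently high power.\<close>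

lemma powr_polynomial_approx:
  fixes a b \<epsilon> :: real
  assumes "b < 0" "b < a" "\<epsilon> > 0"
  obtains c :: "nat \<Rightarrow> real" and m N :: nat where
    "\<And>u. u \<ge> 0 \<Longrightarrow> \<bar>u powr a - (\<Sum>i\<le>m. c i * u powr real i)\<bar> \<le> \<epsilon> * (u powr 0 + u powr b + u powr real N)"
proof -
  \<comment> \<open>Gives \<delta>^(a-b) \<le> \<epsilon>, so that u^a and \<delta>^a are both at
    most \<epsilon> u^b for 0 < u < \<delta>; the bound for \<delta>^a uses that u^b
    decreases.\<close>
  define \<delta> where "\<delta> = min (1/2) (\<epsilon> powr (1 / (a - b)))"
  have \<delta>: "0 < \<delta>" "\<delta> \<le> 1/2" using assms by (auto simp: \<delta>_def)
  have "\<delta> powr (a - b) \<le> (\<epsilon> powr (1 / (a - b))) powr (a - b)"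
    using assms \<delta> by (intro powr_mono2) (auto simp: \<delta>_def)
  then have \<delta>\<epsilon>: "\<delta> powr (a - b) \<le> \<epsilon>" using assms by (simp add: powr_powr)
  have "continuous_on {0..2} (\<lambda>u. max u \<delta> powr a)"
    using \<delta> by (intro continuous_intros) auto
  then obtain g where g: "real_polynomial_function g" "\<And>u. u \<in> {0..2} \<Longrightarrow> \<bar>max u \<delta> powr a - g u\<bar> < \<epsilon>"
    using Stone_Weierstrass_real_polynomial_function[of "{0..2}" "\<lambda>u. max u \<delta> powr a" \<epsilon>] assms(3)
    by auto
  obtain c m where gc: "g = (\<lambda>u. \<Sum>i\<le>m. c i * u ^ i)"
    using g(1) by (auto simp: real_polynomial_function_iff_sum)
  define K where "K = max m (nat \<lceil>a\<rceil>)"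
  have K: "m \<le> K" "a \<le> real K" by (auto simp: K_def) linarith
  \<comment> \<open>For u > 2 both u^a and the polynomial are dominated by multiples of u^K, with
    total factor \<open>D\<close>; then \<open>j\<close> extra powers of u > 2 turn \<open>D\<close>
    into \<epsilon>.\<close>
  define D where "D = 1 + (\<Sum>i\<le>m. \<bar>c i\<bar>)"
  obtain j where j: "D / \<epsilon> < 2 ^ j" using real_arch_pow[of 2 "D / \<epsilon>"] by auto
  show ?thesis
  proof (rule that[of c m "K + j"])
    fix u :: real assume "u \<ge> 0"
    \<comment> \<open>At \<open>u = 0\<close> every \<open>powr\<close> is 0, even with exponent 0,
      so both sides vanish. Writing the monomials with \<open>powr\<close> makes this work.\<close>
    show "\<bar>u powr a - (\<Sum>i\<le>m. c i * u powr real i)\<bar> \<le> \<epsilon> * (u powr 0 + u powr b + u powr real (K + j))"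
    proof (cases "u = 0")
      case False
      with \<open>u \<ge> 0\<close> have u: "u > 0" by simp
      have gu: "(\<Sum>i\<le>m. c i * u powr real i) = g u"
        unfolding gc using u by (simp add: powr_realpow)
      have nn: "0 \<le> \<epsilon> * u powr b" "0 \<le> \<epsilon> * u powr real (K + j)" using assms by auto
      consider "u < \<delta>" | "\<delta> \<le> u" "u \<le> 2" | "u > 2" by linarith
      then have "\<bar>u powr a - g u\<bar> \<le> \<epsilon> + \<epsilon> * u powr b + \<epsilon> * u powr real (K + j)"
      proof cases
        case 1
        have ub: "u powr a \<le> \<epsilon> * u powr b"
        proof -
          have "u powr a = u powr (a - b) * u powr b" by (simp flip: powr_add)
          also have "\<dots> \<le> \<delta> powr (a - b) * u powr b"
            using 1 u assms by (intro mult_right_mono powr_mono2) auto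
          also have "\<dots> \<le> \<epsilon> * u powr b" by (intro mult_right_mono \<delta>\<epsilon>) auto
          finally show ?thesis .
        qed
        have "\<delta> powr a \<le> \<epsilon> * u powr b"
        proof -
          have "\<delta> powr a = \<delta> powr (a - b) * \<delta> powr b" by (simp flip: powr_add)
          also have "\<dots> \<le> \<epsilon> * u powr b"
            using 1 u assms by (intro mult_mono \<delta>\<epsilon> powr_mono2') auto
          finally show ?thesis .
        qed
        moreover have "\<bar>\<delta> powr a - g u\<bar> < \<epsilon>" using g(2)[of u] 1 u \<delta> by (simp add: max_absorb2)
        moreover have "0 \<le> u powr a" "0 \<le> \<delta> powr a" by auto
        ultimately show ?thesis using ub nn(2) by linarith
      next
        case 2
        then have "\<bar>u powr a - g u\<bar> < \<epsilon>" using g(2)[of u] u by (simp add: max_absorb1)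
        then show ?thesis using nn by linarith
      next
        case 3
        have "u powr a \<le> u powr real K" using 3 K by (intro powr_mono) auto
        then have 4: "u powr a \<le> u ^ K" using u by (simp add: powr_realpow)
        have "\<bar>g u\<bar> \<le> (\<Sum>i\<le>m. \<bar>c i\<bar> * u ^ K)"
          unfolding gc
        proof (rule order_trans[OF sum_abs], rule sum_mono)
          fix i assume "i \<in> {..m}"
          then have "u ^ i \<le> u ^ K" using K 3 by (intro power_increasing) auto
          then show "\<bar>c i * u ^ i\<bar> \<le> \<bar>c i\<bar> * u ^ K"
            using u by (simp add: abs_mult mult_left_mono)
        qed
        moreover have "0 \<le> u powr a" by simp
        ultimately have "\<bar>u powr a - g u\<bar> \<le> u ^ K + (\<Sum>i\<le>m. \<bar>c i\<bar> * u ^ K)"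
          using 4 by linarith
        then have "\<bar>u powr a - g u\<bar> \<le> D * u ^ K"
          by (simp add: D_def distrib_right sum_distrib_right)
        also have "\<dots> \<le> (\<epsilon> * u ^ j) * u ^ K"
        proof (intro mult_right_mono)
          have "D \<le> \<epsilon> * 2 ^ j" using j assms(3) by (simp add: divide_less_eq mult.commute)
          also have "\<dots> \<le> \<epsilon> * u ^ j" using 3 assms(3) by (intro mult_left_mono power_mono) auto
          finally show "D \<le> \<epsilon> * u ^ j" .
        qed (use u in auto)
        also have "\<dots> = \<epsilon> * u powr real (K + j)" unfolding powr_realpow[OF u] power_add by (simp add: mult_ac)
        finally show ?thesis using nn(1) assms(3) by linarith
      qed
      then show ?thesis unfolding gu using u by (simp add: distrib_left)
    qed simp
  qed
qed

lemma arcsine_moment_has_integral: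
  assumes "\<alpha> > -1"
  shows "((\<lambda>u. u powr (\<alpha> / 2) * (u powr (-1/2) * (1 - u) powr (-1/2) / (2 * pi))) has_integral arcsine_moment \<alpha>) {0..1}"
proof -
  have "((\<lambda>u. (u powr ((\<alpha> + 1) / 2 - 1) * (1 - u) powr (1/2 - 1)) / (2 * pi)) has_integral arcsine_moment \<alpha>) {0..1}"
    unfolding arcsine_moment_def using assms by (intro has_integral_divide has_integral_Beta_real) auto
  moreover have "(u powr ((\<alpha> + 1) / 2 - 1) * (1 - u) powr (1/2 - 1)) / (2 * pi)
      = u powr (\<alpha> / 2) * (u powr (-1/2) * (1 - u) powr (-1/2) / (2 * pi))" for u :: real
  proof -
    have "(\<alpha> + 1) / 2 - 1 = \<alpha> / 2 + (-1/2)" by (simp add: field_simps)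
    then have "u powr ((\<alpha> + 1) / 2 - 1) = u powr (\<alpha> / 2) * u powr (-1/2)" by (simp only: powr_add)
    then show ?thesis by simp
  qed
  ultimately show ?thesis by (simp only:)
qed

text \<open>The exponent \<open>N\<close> of the approximation depends on \<epsilon>, so the high
  moment multiplied by \<epsilon> needs a bound that is free of \<open>N\<close>.\<close>

lemma arcsine_moment_even_bounds: "0 \<le> arcsine_moment (2 * real k) \<and> arcsine_moment (2 * real k) \<le> 1/2"
proof (induction k)
  case 0
  then show ?case by (simp add: arcsine_moment_0)
next
  case (Suc k)
  have e: "arcsine_moment (2 * real (Suc k)) = (2 * real k + 1) / (2 * real k + 2) * arcsine_moment (2 * real k)"
    using arcsine_moment_add_2[of "2 * real k"] by (simp add: add.commute)
  have "(2 * real k + 1) / (2 * real k + 2) * arcsine_moment (2 * real k) \<le> 1 * (1/2)"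
    using Suc by (intro mult_mono) auto
  then show ?case unfolding e using Suc by simp
qed

text \<open>The polynomial approximation integrated against the arcsine density in the variable u =
  s^2; the counterpart on the limit side of the estimate for Bessel sums.\<close>

lemma arcsine_moment_approx:
  assumes "\<alpha> > -1" "\<beta> > -1"
    and le: "\<And>u. u \<ge> 0 \<Longrightarrow> \<bar>u powr (\<alpha> / 2) - (\<Sum>i\<le>m. c i * u powr real i)\<bar>
      \<le> \<epsilon> * (u powr 0 + u powr (\<beta> / 2) + u powr real N)"
  shows "\<bar>arcsine_moment \<alpha> - (\<Sum>i\<le>m. c i * arcsine_moment (2 * real i))\<bar>
    \<le> \<epsilon> * (arcsine_moment 0 + arcsine_moment \<beta> + arcsine_moment (2 * real N))"
proof -
  define k where "k u = u powr (-1/2) * (1 - u) powr (-1/2) / (2 * pi)" for u :: real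
  have k: "k u \<ge> 0" for u by (simp add: k_def)
  have I: "((\<lambda>u. u powr (\<gamma> / 2) * k u) has_integral arcsine_moment \<gamma>) {0..1}" if "\<gamma> > -1" for \<gamma>
    unfolding k_def by (rule arcsine_moment_has_integral[OF that])
  have I0: "((\<lambda>u. u powr 0 * k u) has_integral arcsine_moment 0) {0..1}" using I[of 0] by simp
  have In: "((\<lambda>u. u powr real i * k u) has_integral arcsine_moment (2 * real i)) {0..1}" for i
    using I[of "2 * real i"] by simp
  define F where "F u = (u powr (\<alpha> / 2) - (\<Sum>i\<le>m. c i * u powr real i)) * k u" for u
  define G where "G u = \<epsilon> * (u powr 0 + u powr (\<beta> / 2) + u powr real N) * k u" for u
  have "((\<lambda>u. u powr (\<alpha> / 2) * k u - (\<Sum>i\<le>m. c i * (u powr real i * k u))) has_integral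
      arcsine_moment \<alpha> - (\<Sum>i\<le>m. c i * arcsine_moment (2 * real i))) {0..1}"
    by (intro has_integral_diff has_integral_sum has_integral_mult_right I In assms finite_atMost)
  moreover have "(\<lambda>u. u powr (\<alpha> / 2) * k u - (\<Sum>i\<le>m. c i * (u powr real i * k u))) = F"
    by (rule ext) (simp add: F_def left_diff_distrib sum_distrib_right mult.assoc)
  ultimately have F: "(F has_integral arcsine_moment \<alpha> - (\<Sum>i\<le>m. c i * arcsine_moment (2 * real i))) {0..1}"
    by simp
  have "((\<lambda>u. \<epsilon> * (u powr 0 * k u + u powr (\<beta> / 2) * k u + u powr real N * k u)) has_integral
      \<epsilon> * (arcsine_moment 0 + arcsine_moment \<beta> + arcsine_moment (2 * real N))) {0..1}"
    by (intro has_integral_mult_right has_integral_add I In I0 assms)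
  moreover have "(\<lambda>u. \<epsilon> * (u powr 0 * k u + u powr (\<beta> / 2) * k u + u powr real N * k u)) = G"
    by (rule ext) (simp add: G_def distrib_right distrib_left mult.assoc)
  ultimately have G: "(G has_integral
      \<epsilon> * (arcsine_moment 0 + arcsine_moment \<beta> + arcsine_moment (2 * real N))) {0..1}" by simp
  have FG: "\<bar>F u\<bar> \<le> G u" if "u \<in> {0..1}" for u
    using mult_right_mono[OF le[of u] k[of u]] that k[of u] by (simp add: F_def G_def abs_mult)
  have "arcsine_moment \<alpha> - (\<Sum>i\<le>m. c i * arcsine_moment (2 * real i))
      \<le> \<epsilon> * (arcsine_moment 0 + arcsine_moment \<beta> + arcsine_moment (2 * real N))"
    by (rule has_integral_le[OF F G]) (use FG in \<open>simp add: abs_le_iff\<close>)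
  moreover have "- (arcsine_moment \<alpha> - (\<Sum>i\<le>m. c i * arcsine_moment (2 * real i)))
      \<le> \<epsilon> * (arcsine_moment 0 + arcsine_moment \<beta> + arcsine_moment (2 * real N))"
    by (rule has_integral_le[OF has_integral_neg[OF F] G]) (use FG in \<open>simp add: abs_le_iff\<close>)
  ultimately show ?thesis by (simp add: abs_le_iff)
qed

text \<open>Comparison with the integral of x^\<beta>, done by the mean value theorem on [N, N+1]:
  since x^\<beta> decreases, its value at an inner point exceeds that at the right end. The interval
  at 0 reduces to \<beta> + 1 \<le> 1.\<close>

lemma sum_powr_le:
  fixes \<beta> :: real
  assumes "-1 < \<beta>" "\<beta> < 0"
  shows "(\<Sum>n<N. real (Suc n) powr \<beta>) \<le> real N powr (\<beta> + 1) / (\<beta> + 1)"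
proof (induction N)
  case (Suc N)
  have "(\<beta> + 1) * real (Suc N) powr \<beta> \<le> real (Suc N) powr (\<beta> + 1) - real N powr (\<beta> + 1)"
  proof (cases "N = 0")
    case False
    have "\<exists>z>real N. z < real (Suc N) \<and> real (Suc N) powr (\<beta> + 1) - real N powr (\<beta> + 1)
        = (real (Suc N) - real N) * ((\<beta> + 1) * z powr \<beta>)"
    proof (rule MVT2)
      fix x assume "real N \<le> x" "x \<le> real (Suc N)"
      with False have "x > 0" by linarith
      then show "((\<lambda>x. x powr (\<beta> + 1)) has_real_derivative (\<beta> + 1) * x powr \<beta>) (at x)"
        using has_real_derivative_powr[of x "\<beta> + 1"] by simp
    qed simp
    then obtain z where z: "real N < z" "z < real (Suc N)"
      "real (Suc N) powr (\<beta> + 1) - real N powr (\<beta> + 1) = (\<beta> + 1) * z powr \<beta>" by auto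
    have "real (Suc N) powr \<beta> \<le> z powr \<beta>" using z assms by (intro powr_mono2') auto
    then show ?thesis unfolding z(3) using assms by (intro mult_left_mono) auto
  qed (use assms in simp)
  then have "real (Suc N) powr \<beta> \<le> (real (Suc N) powr (\<beta> + 1) - real N powr (\<beta> + 1)) / (\<beta> + 1)"
    using assms by (simp add: pos_le_divide_eq mult.commute)
  with Suc show ?case by (simp add: diff_divide_distrib)
qed simp

text \<open>The sum is split at l = r/2. Below, J_l^2 \<le> C/r and the sum of l^\<beta> is
  O(r^(\<beta>+1)); above, l^\<beta> \<le> (r/2)^\<beta> and the total mass is at most 1.\<close>

lemma bessel_sum_powr_bounded:
  assumes "-1 < \<beta>" "\<beta> < 0"
  obtains B where "\<forall>\<^sub>F r in at_top. bessel_sum (\<lambda>n. real n powr \<beta>) r / r powr \<beta> \<le> B"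
proof -
  obtain C where C: "C > 0" "\<And>l x. x \<ge> 1 \<Longrightarrow> 2 * real l \<le> x \<Longrightarrow> (bessel_J l x)\<^sup>2 \<le> C / x"
    using bessel_J_squared_bound by metis
  have "\<forall>\<^sub>F r in at_top. bessel_sum (\<lambda>n. real n powr \<beta>) r / r powr \<beta> \<le> C / (\<beta> + 1) + 2 powr (- \<beta>)"
    using eventually_ge_at_top[of 1]
  proof eventually_elim
    case (elim r)
    define N where "N = nat \<lfloor>r / 2\<rfloor>"
    have N: "real N \<le> r" "\<And>n. n < Suc N \<Longrightarrow> 2 * real n \<le> r" "\<And>n. n \<ge> Suc N \<Longrightarrow> r / 2 \<le> real n"
      using elim unfolding N_def by linarith+
    define v where "v n = (if n < Suc N then real n powr \<beta> else 0)" for n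
    have sv: "subexp v"
      unfolding v_def[abs_def] by (rule subexp_truncate)
    have c: "subexp (\<lambda>n. (r / 2) powr \<beta> * 1)" by (intro subexp_cmult subexp_const)
    have "\<bar>bessel_sum (\<lambda>n. real n powr \<beta>) r\<bar> \<le> bessel_sum (\<lambda>n. v n + (r / 2) powr \<beta> * 1) r"
    proof (rule abs_bessel_sum_le)
      fix n :: nat assume "n > 0"
      show "\<bar>real n powr \<beta>\<bar> \<le> v n + (r / 2) powr \<beta> * 1"
      proof (cases "n < Suc N")
        case False
        then have "real n powr \<beta> \<le> (r / 2) powr \<beta>" using elim assms N(3)[of n] by (intro powr_mono2') auto
        then show ?thesis using False by (simp add: v_def)
      qed (simp add: v_def)
    qed (use elim in \<open>auto intro!: subexp_powr subexp_add sv subexp_cmult subexp_const\<close>)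
    also have "\<dots> = bessel_sum v r + (r / 2) powr \<beta> * bessel_sum (\<lambda>_. 1) r"
      using elim bessel_sum_add[OF sv c, of r] bessel_sum_cmult[OF subexp_const[of 1], of r "(r/2) powr \<beta>"] by simp
    also have "\<dots> \<le> C / (\<beta> + 1) * r powr \<beta> + (r / 2) powr \<beta> * 1"
    proof (rule add_mono)
      have "bessel_sum v r = (\<Sum>n<N. real (Suc n) powr \<beta> * (bessel_J (Suc n) r)\<^sup>2)"
        unfolding bessel_sum_def by (subst suminf_finite[of "{..<N}"]) (auto simp: v_def)
      also have "\<dots> \<le> (\<Sum>n<N. real (Suc n) powr \<beta> * (C / r))"
      proof (intro sum_mono mult_left_mono)
        fix n assume "n \<in> {..<N}"
        then show "(bessel_J (Suc n) r)\<^sup>2 \<le> C / r" using N(2)[of "Suc n"] elim by (intro C) auto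
      qed simp
      also have "\<dots> = (\<Sum>n<N. real (Suc n) powr \<beta>) * (C / r)" by (simp only: sum_distrib_right)
      also have "\<dots> \<le> (r powr (\<beta> + 1) / (\<beta> + 1)) * (C / r)"
      proof (intro mult_right_mono order_trans[OF sum_powr_le[OF assms]] divide_right_mono powr_mono2)
      qed (use N(1) assms elim C(1) in auto)
      also have "\<dots> = C / (\<beta> + 1) * r powr \<beta>"
        using elim by (simp add: powr_add)
      finally show "bessel_sum v r \<le> C / (\<beta> + 1) * r powr \<beta>" .
      have "bessel_sum (\<lambda>_. 1) r \<le> 1"
      proof -
        have "bessel_sum (\<lambda>_. 1) r = (1 - (bessel_J 0 r)\<^sup>2) / 2"
          using bessel_J_sum_squares[of r] elim by (simp add: bessel_sum_def)
        also have "\<dots> \<le> 1" 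
        proof -
          have "(1 - x) / 2 \<le> 1" if "0 \<le> x" for x :: real using that by simp
          then show ?thesis using zero_le_power2 .
        qed
        finally show ?thesis .
      qed
      then show "(r / 2) powr \<beta> * bessel_sum (\<lambda>_. 1) r \<le> (r / 2) powr \<beta> * 1"
        by (intro mult_left_mono) auto
    qed
    also have "\<dots> = (C / (\<beta> + 1) + 2 powr (- \<beta>)) * r powr \<beta>"
    proof -
      have "(r / 2) powr \<beta> = 2 powr (- \<beta>) * r powr \<beta>"
        using elim by (simp add: powr_divide powr_minus_divide)
      then show ?thesis by (simp add: distrib_right)
    qed
    finally show ?case using elim by (simp add: divide_le_eq)
  qed
  then show ?thesis by (rule that)
qed

lemma bessel_sum_sum:
  assumes "\<And>i. subexp (w i)" "r > 0"
  shows "subexp (\<lambda>n. \<Sum>i\<le>m. w i n) \<and> bessel_sum (\<lambda>n. \<Sum>i\<le>m. w i n) r = (\<Sum>i\<le>(m::nat). bessel_sum (w i) r)"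
proof (induction m)
  case 0
  then show ?case using assms by simp
next
  case (Suc m)
  then show ?case using assms by (simp add: subexp_add bessel_sum_add)
qed

text \<open>
  In the variable \<open>u = (l/r)\<^sup>2\<close> the even moments integrate polynomials; the error of a polynomial
  approximation of \<open>u powr (\<alpha>/2)\<close> is absorbed by \<open>u powr (\<beta>/2)\<close> near \<open>0\<close> and by a high power
  of \<open>u\<close> near infinity.
\<close>

theorem bessel_sum_powr_asymp:
  assumes "\<alpha> > -1"
  shows "((\<lambda>r. bessel_sum (\<lambda>n. real n powr \<alpha>) r / r powr \<alpha>) \<longlongrightarrow> arcsine_moment \<alpha>) at_top"
proof (rule tendstoI)
  fix e :: real assume e: "e > 0"
  define R where "R \<gamma> r = bessel_sum (\<lambda>n. real n powr \<gamma>) r / r powr \<gamma>" for \<gamma> r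
  define M where "M = arcsine_moment"
  \<comment> \<open>The midpoint between -1 and min(\<alpha>, 0): more singular than the target,
    still with a finite moment.\<close>
  define \<beta> where "\<beta> = (min \<alpha> 0 - 1) / 2"
  have \<beta>: "-1 < \<beta>" "\<beta> < 0" "\<beta> < \<alpha>" using assms by (auto simp: \<beta>_def min_def)
  obtain B where B: "\<forall>\<^sub>F r in at_top. R \<beta> r \<le> B"
    using bessel_sum_powr_bounded[OF \<beta>(1,2)] unfolding R_def by metis
  \<comment> \<open>The denominator adds up three errors: \<open>2 + \<bar>B\<bar>\<close> from the
    Bessel sums, 1 from convergence of the polynomial part, and
    \<open>1 + \<bar>M \<beta>\<bar>\<close> from the arcsine moments.\<close>
  define \<epsilon> where "\<epsilon> = e / (4 + \<bar>B\<bar> + \<bar>M \<beta>\<bar>)"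
  have "0 < 4 + \<bar>B\<bar> + \<bar>M \<beta>\<bar>" by linarith
  then have \<epsilon>: "\<epsilon> > 0" "\<epsilon> * (4 + \<bar>B\<bar> + \<bar>M \<beta>\<bar>) = e" using e by (auto simp: \<epsilon>_def)
  obtain c m N where le: "\<And>u. u \<ge> 0 \<Longrightarrow> \<bar>u powr (\<alpha> / 2) - (\<Sum>i\<le>m. c i * u powr real i)\<bar>
      \<le> \<epsilon> * (u powr 0 + u powr (\<beta> / 2) + u powr real N)"
    using powr_polynomial_approx[of "\<beta> / 2" "\<alpha> / 2" \<epsilon>] \<beta> \<epsilon>(1) by auto
  have ev: "((\<lambda>r. R (2 * real i) r) \<longlongrightarrow> M (2 * real i)) at_top" for i
    unfolding R_def M_def by (rule bessel_sum_even_moments)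
  have sub: "subexp (\<lambda>n. c * (real n powr \<gamma> / r powr \<gamma>))" for c \<gamma> r
    using subexp_cmult[OF subexp_powr, of "c / r powr \<gamma>"] by simp
  have R_eq: "bessel_sum (\<lambda>n. c * (real n powr \<gamma> / r powr \<gamma>)) r = c * R \<gamma> r" if "r > 0" for c \<gamma> r
    using bessel_sum_cmult[OF subexp_powr[of \<gamma>] that, of "c / r powr \<gamma>"] by (simp add: R_def)
  have key: "\<bar>R \<alpha> r - (\<Sum>i\<le>m. c i * R (2 * real i) r)\<bar> \<le> \<epsilon> * (R 0 r + R \<beta> r + R (2 * real N) r)"
    if r: "r > 0" for r
  proof -
    let ?q = "\<lambda>\<gamma> n. real n powr \<gamma> / r powr \<gamma>"
    let ?P = "\<lambda>n. \<Sum>i\<le>m. c i * ?q (2 * real i) n"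
    have P: "subexp ?P" "bessel_sum ?P r = (\<Sum>i\<le>m. c i * R (2 * real i) r)"
      using bessel_sum_sum[OF sub r] R_eq[OF r] by auto
    have e1: "bessel_sum (\<lambda>n. 1 * ?q \<alpha> n + (-1) * ?P n) r = R \<alpha> r - (\<Sum>i\<le>m. c i * R (2 * real i) r)"
      unfolding bessel_sum_add[OF sub subexp_cmult[OF P(1)] r] bessel_sum_cmult[OF P(1) r] P(2) R_eq[OF r]
      by simp
    have e2: "bessel_sum (\<lambda>n. \<epsilon> * ?q 0 n + (\<epsilon> * ?q \<beta> n + \<epsilon> * ?q (2 * real N) n)) r
        = \<epsilon> * (R 0 r + R \<beta> r + R (2 * real N) r)"
      unfolding bessel_sum_add[OF sub subexp_add[OF sub sub] r] bessel_sum_add[OF sub sub r] R_eq[OF r]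
      by (simp add: distrib_left)
    have "\<bar>bessel_sum (\<lambda>n. 1 * ?q \<alpha> n + (-1) * ?P n) r\<bar>
        \<le> bessel_sum (\<lambda>n. \<epsilon> * ?q 0 n + (\<epsilon> * ?q \<beta> n + \<epsilon> * ?q (2 * real N) n)) r"
    proof (rule abs_bessel_sum_le[OF _ _ r])
      show "subexp (\<lambda>n. 1 * ?q \<alpha> n + (-1) * ?P n)" by (intro subexp_add sub subexp_cmult P)
      show "subexp (\<lambda>n. \<epsilon> * ?q 0 n + (\<epsilon> * ?q \<beta> n + \<epsilon> * ?q (2 * real N) n))" by (intro subexp_add sub)
      fix n :: nat assume "n > 0"
      define u where "u = (real n / r) powr 2"
      have q: "?q (2 * \<gamma>) n = u powr \<gamma>" for \<gamma>
        unfolding u_def powr_powr using r by (simp add: powr_divide)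
      have "u \<ge> 0" by (simp add: u_def)
      from le[OF this] show "\<bar>1 * ?q \<alpha> n + (-1) * ?P n\<bar>
          \<le> \<epsilon> * ?q 0 n + (\<epsilon> * ?q \<beta> n + \<epsilon> * ?q (2 * real N) n)"
        using q[of "\<alpha> / 2"] q[of "\<beta> / 2"] q[of 0] by (simp add: q distrib_left)
    qed
    then show ?thesis unfolding e1 e2 .
  qed
  have M: "\<bar>M \<alpha> - (\<Sum>i\<le>m. c i * M (2 * real i))\<bar> \<le> \<epsilon> * (1 + \<bar>M \<beta>\<bar>)"
  proof -
    have "\<bar>M \<alpha> - (\<Sum>i\<le>m. c i * M (2 * real i))\<bar> \<le> \<epsilon> * (M 0 + M \<beta> + M (2 * real N))"
      unfolding M_def by (rule arcsine_moment_approx[OF assms \<beta>(1) le])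
    also have "\<dots> \<le> \<epsilon> * (1 + \<bar>M \<beta>\<bar>)"
      using \<epsilon>(1) arcsine_moment_even_bounds[of N] arcsine_moment_0
      by (intro mult_left_mono) (auto simp: M_def)
    finally show ?thesis .
  qed
  have "((\<lambda>r. \<Sum>i\<le>m. c i * R (2 * real i) r) \<longlongrightarrow> (\<Sum>i\<le>m. c i * M (2 * real i))) at_top"
    by (intro tendsto_sum tendsto_mult_left ev)
  from tendstoD[OF this \<epsilon>(1)]
  have 1: "\<forall>\<^sub>F r in at_top. \<bar>(\<Sum>i\<le>m. c i * R (2 * real i) r) - (\<Sum>i\<le>m. c i * M (2 * real i))\<bar> < \<epsilon>"
    by (simp add: dist_real_def)
  have 2: "\<forall>\<^sub>F r in at_top. R (2 * real i) r < 1" for i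
    using arcsine_moment_even_bounds[of i] by (intro order_tendstoD(2)[OF ev]) (simp add: M_def)
  show "\<forall>\<^sub>F r in at_top. dist (bessel_sum (\<lambda>n. real n powr \<alpha>) r / r powr \<alpha>) (arcsine_moment \<alpha>) < e"
    using 1 2[of 0] 2[of N] B eventually_gt_at_top[of 0]
  proof eventually_elim
    case (elim r)
    have "\<epsilon> * (R 0 r + R \<beta> r + R (2 * real N) r) \<le> \<epsilon> * (2 + \<bar>B\<bar>)"
      using elim \<epsilon>(1) by (intro mult_left_mono) auto
    then have "\<bar>R \<alpha> r - M \<alpha>\<bar> < \<epsilon> * (2 + \<bar>B\<bar>) + \<epsilon> + \<epsilon> * (1 + \<bar>M \<beta>\<bar>)"
      using key[OF elim(5)] M elim(1) by linarith
    also have "\<dots> = e" unfolding \<epsilon>(2)[symmetric] by (simp add: algebra_simps)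
    finally show ?case by (simp add: dist_real_def R_def M_def)
  qed
qed

section \<open>Sums with derivatives\<close>

definition weighted_sum :: "(nat \<Rightarrow> real) \<Rightarrow> (nat \<Rightarrow> real \<Rightarrow> real) \<Rightarrow> real \<Rightarrow> real" where
  "weighted_sum w f r = (\<Sum>n. w (Suc n) * f (Suc n) r)"

lemma weighted_sums:
  "subexp w \<Longrightarrow> geo_dom (1/4) f \<Longrightarrow> r > 0 \<Longrightarrow> (\<lambda>n. w (Suc n) * f (Suc n) r) sums weighted_sum w f r"
  unfolding weighted_sum_def by (rule summable_sums) (rule summable_weighted)

abbreviation "JdJ_sum w \<equiv> weighted_sum w (\<lambda>l x. bessel_J l x * dJ l x)"
abbreviation "dJdJ_sum w \<equiv> weighted_sum w (\<lambda>l x. (dJ l x)\<^sup>2)"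
abbreviation "JddJ_sum w \<equiv> weighted_sum w (\<lambda>l x. bessel_J l x * ddJ l x)"
abbreviation "dJddJ_sum w \<equiv> weighted_sum w (\<lambda>l x. dJ l x * ddJ l x)"
abbreviation "ddJddJ_sum w \<equiv> weighted_sum w (\<lambda>l x. (ddJ l x)\<^sup>2)"

lemmas bessel_product_sums =
  bessel_sum_sums
  weighted_sums[OF _ geo_dom_bessel_products(2)]
  weighted_sums[OF _ geo_dom_bessel_products(3)]
  weighted_sums[OF _ geo_dom_bessel_products(4)]
  weighted_sums[OF _ geo_dom_bessel_products(5)]
  weighted_sums[OF _ geo_dom_bessel_products(6)]

text \<open>General weights replace (n + \<beta>)^\<alpha> because the recurrences shift the index
  by one and Bessel's equation multiplies by n^2; both operations stay within this class.\<close>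

definition asymp_weight :: "(nat \<Rightarrow> real) \<Rightarrow> real \<Rightarrow> bool" where
  "asymp_weight w \<alpha> \<longleftrightarrow> (\<lambda>n. w n / real n powr \<alpha>) \<longlonglongrightarrow> 1"

abbreviation "sq_weight w \<equiv> (\<lambda>n. (real n)\<^sup>2 * w n)"

lemma asymp_weight_subexp: "asymp_weight w \<alpha> \<Longrightarrow> subexp w"
  unfolding asymp_weight_def by (rule subexp_powr_asymp)

lemma asymp_weight_shifted_powr: "asymp_weight (\<lambda>n. (real n + \<beta>) powr \<alpha>) \<alpha>"
  unfolding asymp_weight_def by real_asymp

lemma asymp_weight_sq:
  assumes "asymp_weight w \<alpha>" shows "asymp_weight (sq_weight w) (\<alpha> + 2)"
proof -
  have "\<forall>\<^sub>F n in sequentially. w n / real n powr \<alpha> = (real n)\<^sup>2 * w n / real n powr (\<alpha> + 2)"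
    using eventually_gt_at_top[of 0]
    by eventually_elim (simp add: powr_add)
  then show ?thesis using assms unfolding asymp_weight_def by (rule Lim_transform_eventually[rotated])
qed

lemma asymp_weight_abs:
  assumes "asymp_weight w \<alpha>" shows "asymp_weight (\<lambda>n. \<bar>w n\<bar>) \<alpha>"
  using tendsto_rabs[OF assms[unfolded asymp_weight_def]]
  unfolding asymp_weight_def by (simp add: abs_divide)

lemma asymp_weight_Suc:
  assumes "asymp_weight w \<alpha>" shows "asymp_weight (\<lambda>n. w (Suc n)) \<alpha>"
proof -
  have "(\<lambda>n. w (Suc n) / real (Suc n) powr \<alpha>) \<longlonglongrightarrow> 1"
    using LIMSEQ_Suc[OF assms[unfolded asymp_weight_def]] .
  moreover have "(\<lambda>n. (real n + 1) powr \<alpha> / real n powr \<alpha>) \<longlonglongrightarrow> 1"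
    using asymp_weight_shifted_powr[of 1 \<alpha>] by (simp add: asymp_weight_def)
  ultimately have "(\<lambda>n. w (Suc n) / real (Suc n) powr \<alpha> * ((real n + 1) powr \<alpha> / real n powr \<alpha>)) \<longlonglongrightarrow> 1 * 1"
    by (rule tendsto_mult)
  moreover have "w (Suc n) / real (Suc n) powr \<alpha> * ((real n + 1) powr \<alpha> / real n powr \<alpha>) = w (Suc n) / real n powr \<alpha>" for n
    by (simp add: add.commute)
  ultimately show ?thesis unfolding asymp_weight_def by simp
qed

lemma asymp_weight_pred:
  assumes "asymp_weight w \<alpha>" shows "asymp_weight (\<lambda>n. w (n - 1)) \<alpha>"
proof -
  have "(\<lambda>n. w n / real n powr \<alpha> * (real n powr \<alpha> / (real n + 1) powr \<alpha>)) \<longlonglongrightarrow> 1 * 1"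
    by (intro tendsto_mult assms[unfolded asymp_weight_def]) real_asymp
  moreover have "\<forall>\<^sub>F n in sequentially. w n / real n powr \<alpha> * (real n powr \<alpha> / (real n + 1) powr \<alpha>)
      = w (Suc n - 1) / real (Suc n) powr \<alpha>"
    using eventually_gt_at_top[of 0]
    by eventually_elim (simp add: add.commute)
  ultimately have "(\<lambda>n. w (Suc n - 1) / real (Suc n) powr \<alpha>) \<longlonglongrightarrow> 1"
    by (simp add: Lim_transform_eventually)
  then show ?thesis unfolding asymp_weight_def by (rule LIMSEQ_imp_Suc)
qed

lemma bessel_sum_asymp:
  assumes "\<alpha> > -1" "asymp_weight w \<alpha>"
  shows "((\<lambda>r. bessel_sum w r / r powr \<alpha>) \<longlongrightarrow> arcsine_moment \<alpha>) at_top"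
  using bessel_sum_asymp_transfer[OF assms(1) _ bessel_sum_powr_asymp[OF assms(1)], of w 1] assms(2)
  by (simp add: asymp_weight_def)

lemma tendsto_div_power_powr_zero: "((\<lambda>r. f r / r powr \<alpha>) \<longlongrightarrow> L) at_top \<Longrightarrow> k > 0 \<Longrightarrow>
    ((\<lambda>r. (f r / r ^ k) / r powr \<alpha>) \<longlongrightarrow> 0) at_top" for L :: real
proof -
  assume f: "((\<lambda>r. f r / r powr \<alpha>) \<longlongrightarrow> L) at_top" and k: "k > 0"
  have "((\<lambda>r. 1 / r ^ k) \<longlongrightarrow> (0::real)) at_top"
    using k by (intro tendsto_divide_0[OF tendsto_const] filterlim_at_top_imp_at_infinity
        filterlim_pow_at_top filterlim_ident)
  from tendsto_mult[OF f this] show ?thesis by (simp add: mult.commute)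
qed

lemma tendsto_powr_add_nat:
  assumes "((\<lambda>r. f r / r powr (\<alpha> + real k)) \<longlongrightarrow> L) at_top"
  shows "((\<lambda>r. (f r / r ^ k) / r powr \<alpha>) \<longlongrightarrow> L) at_top"
proof -
  have "\<forall>\<^sub>F r in at_top. f r / r powr (\<alpha> + real k) = (f r / r ^ k) / r powr \<alpha>"
    using eventually_gt_at_top[of 0] by eventually_elim (simp add: powr_add powr_realpow mult.commute)
  with assms show ?thesis by (rule Lim_transform_eventually)
qed

lemma tendsto_over_powr_cong:
  assumes "((\<lambda>r. f r / r powr \<alpha>) \<longlongrightarrow> L) at_top" "\<And>r. r > 0 \<Longrightarrow> f r = g r"
  shows "((\<lambda>r. g r / r powr \<alpha>) \<longlongrightarrow> (L::real)) at_top"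
proof (rule Lim_transform_eventually[OF assms(1)])
  show "\<forall>\<^sub>F r in at_top. f r / r powr \<alpha> = g r / r powr \<alpha>"
    using eventually_gt_at_top[of 0] by eventually_elim (simp add: assms(2))
qed

text \<open>J_l' and (l/r) J_l are the half difference and the half sum of J_(l-1) and J_(l+1), so
  the parallelogram law expresses J_l'^2 through squares alone.\<close>

lemma dJdJ_sum_eq:
  assumes "asymp_weight w \<alpha>" "r > 0"
  shows "dJdJ_sum w r = (bessel_sum (\<lambda>n. w (Suc n)) r + w 1 * (bessel_J 0 r)\<^sup>2) / 2
    + (bessel_sum (\<lambda>n. w (n - 1)) r - w 0 * (bessel_J 1 r)\<^sup>2) / 2 - bessel_sum (sq_weight w) r / r ^ 2"
proof -
  note aw = asymp_weight_Suc[OF assms(1), THEN asymp_weight_subexp]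
    asymp_weight_pred[OF assms(1), THEN asymp_weight_subexp] asymp_weight_sq[OF assms(1), THEN asymp_weight_subexp]
  note s = sums_diff[OF sums_add[OF sums_divide[OF bessel_sum_shift_down[OF aw(1) assms(2)], of 2]
      sums_divide[OF bessel_sum_shift_up[OF aw(2) assms(2)], of 2]]
      sums_divide[OF bessel_sum_sums[OF aw(3) assms(2)], of "r ^ 2"]]
  have "w (Suc n) * (bessel_J n r)\<^sup>2 / 2 + w (Suc n) * (bessel_J (Suc (Suc n)) r)\<^sup>2 / 2
      - (real (Suc n))\<^sup>2 * w (Suc n) * (bessel_J (Suc n) r)\<^sup>2 / r ^ 2 = w (Suc n) * (dJ (Suc n) r)\<^sup>2" for n
  proof -
    define j k where "j = bessel_J n r" and "k = real (Suc n) / r * bessel_J (Suc n) r"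
    have 1: "dJ (Suc n) r = j - k" "bessel_J (Suc (Suc n)) r = 2 * k - j"
      using assms(2) by (simp_all add: dJ_Suc_eq bessel_J_recurrence j_def k_def del: of_nat_Suc)
    have 2: "(real (Suc n))\<^sup>2 * w (Suc n) * (bessel_J (Suc n) r)\<^sup>2 / r ^ 2 = w (Suc n) * k\<^sup>2"
      by (simp add: k_def power_mult_distrib power_divide del: of_nat_Suc)
    show ?thesis unfolding 1 2 j_def[symmetric] by (simp add: power2_eq_square field_simps)
  qed
  then show ?thesis using sums_unique[OF s] by (simp only: weighted_sum_def)
qed

lemma dJdJ_sum_asymp:
  assumes "\<alpha> > -1" "asymp_weight w \<alpha>"
  shows "((\<lambda>r. dJdJ_sum w r / r powr \<alpha>) \<longlongrightarrow> arcsine_moment \<alpha> - arcsine_moment (\<alpha> + 2)) at_top"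
proof -
  have sq: "((\<lambda>r. (bessel_sum (sq_weight w) r / r ^ 2) / r powr \<alpha>) \<longlongrightarrow> arcsine_moment (\<alpha> + 2)) at_top"
    using bessel_sum_asymp[OF _ asymp_weight_sq[OF assms(2)]] assms(1)
    by (intro tendsto_powr_add_nat) simp
  have "((\<lambda>r. (bessel_sum (\<lambda>n. w (Suc n)) r / r powr \<alpha> + w 1 * ((bessel_J 0 r)\<^sup>2 / r powr \<alpha>)) / 2
      + (bessel_sum (\<lambda>n. w (n - 1)) r / r powr \<alpha> - w 0 * ((bessel_J 1 r)\<^sup>2 / r powr \<alpha>)) / 2
      - (bessel_sum (sq_weight w) r / r ^ 2) / r powr \<alpha>) \<longlongrightarrow>
      (arcsine_moment \<alpha> + w 1 * 0) / 2 + (arcsine_moment \<alpha> - w 0 * 0) / 2 - arcsine_moment (\<alpha> + 2)) at_top"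
    by (intro tendsto_add tendsto_diff tendsto_divide tendsto_const tendsto_mult_left sq
        bessel_J_squared_over_powr bessel_sum_asymp asymp_weight_Suc asymp_weight_pred assms) simp_all
  then have "((\<lambda>r. ((bessel_sum (\<lambda>n. w (Suc n)) r + w 1 * (bessel_J 0 r)\<^sup>2) / 2
    + (bessel_sum (\<lambda>n. w (n - 1)) r - w 0 * (bessel_J 1 r)\<^sup>2) / 2 - bessel_sum (sq_weight w) r / r ^ 2) / r powr \<alpha>)
      \<longlongrightarrow> arcsine_moment \<alpha> - arcsine_moment (\<alpha> + 2)) at_top"
    by (simp add: add_divide_distrib diff_divide_distrib mult.commute)
  then show ?thesis by (rule tendsto_over_powr_cong) (simp only: dJdJ_sum_eq[OF assms(2)])
qed

text \<open>A crude estimate, which gives O(r^\<alpha>). That is enough wherever the sum is divided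
  by r, in particular in Bessel's equation, before the sharper o(r^\<alpha>) is available. General
  weights may be negative, hence the absolute values.\<close>

lemma abs_JdJ_sum_le:
  assumes "asymp_weight w \<alpha>" "r > 0"
  shows "\<bar>JdJ_sum w r\<bar> \<le> bessel_sum (\<lambda>n. \<bar>w n\<bar>) r + dJdJ_sum (\<lambda>n. \<bar>w n\<bar>) r"
proof -
  have s: "subexp (\<lambda>n. \<bar>w n\<bar>)" using assms(1) by (intro subexp_abs asymp_weight_subexp)
  note s2 = sums_add[OF bessel_product_sums(1)[OF s assms(2)] bessel_product_sums(3)[OF s assms(2)]]
  have b: "norm (w (Suc n) * (bessel_J (Suc n) r * dJ (Suc n) r))
      \<le> \<bar>w (Suc n)\<bar> * (bessel_J (Suc n) r)\<^sup>2 + \<bar>w (Suc n)\<bar> * (dJ (Suc n) r)\<^sup>2" for n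
  proof -
    have "\<bar>x * y\<bar> \<le> x\<^sup>2 + y\<^sup>2" for x y :: real
    proof -
      have "2 * (\<bar>x\<bar> * \<bar>y\<bar>) \<le> x\<^sup>2 + y\<^sup>2" using sum_squares_bound[of "\<bar>x\<bar>" "\<bar>y\<bar>"] by simp
      moreover have "0 \<le> \<bar>x\<bar> * \<bar>y\<bar>" by simp
      ultimately show ?thesis unfolding abs_mult by linarith
    qed
    from mult_left_mono[OF this, of "\<bar>w (Suc n)\<bar>" "bessel_J (Suc n) r" "dJ (Suc n) r"]
    show ?thesis by (simp add: abs_mult distrib_left)
  qed
  have "norm (JdJ_sum w r) \<le> bessel_sum (\<lambda>n. \<bar>w n\<bar>) r + dJdJ_sum (\<lambda>n. \<bar>w n\<bar>) r"
    unfolding sums_unique[OF s2] unfolding weighted_sum_def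
    by (rule norm_suminf_le[OF b sums_summable[OF s2]])
  then show ?thesis by simp
qed

lemma JdJ_sum_over_tendsto:
  assumes "\<alpha> > -1" "asymp_weight w \<alpha>"
  shows "((\<lambda>r. (JdJ_sum w r / r) / r powr \<alpha>) \<longlongrightarrow> 0) at_top"
proof -
  let ?g = "\<lambda>r. bessel_sum (\<lambda>n. \<bar>w n\<bar>) r + dJdJ_sum (\<lambda>n. \<bar>w n\<bar>) r"
  have "((\<lambda>r. ?g r / r powr \<alpha>) \<longlongrightarrow> arcsine_moment \<alpha> + (arcsine_moment \<alpha> - arcsine_moment (\<alpha> + 2))) at_top"
    unfolding add_divide_distrib
    by (intro tendsto_add bessel_sum_asymp dJdJ_sum_asymp asymp_weight_abs assms)
  from tendsto_div_power_powr_zero[OF this, of 1]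
  have "((\<lambda>r. ?g r / r / r powr \<alpha>) \<longlongrightarrow> 0) at_top" by simp
  moreover have "\<forall>\<^sub>F r in at_top. norm ((JdJ_sum w r / r) / r powr \<alpha>) \<le> ?g r / r / r powr \<alpha>"
    using eventually_gt_at_top[of 0]
  proof eventually_elim
    case (elim r)
    have "\<bar>JdJ_sum w r\<bar> / r / r powr \<alpha> \<le> ?g r / r / r powr \<alpha>"
      using elim by (intro divide_right_mono abs_JdJ_sum_le[OF assms(2)]) auto
    then show ?case using elim by (simp add: abs_divide)
  qed
  ultimately show ?thesis by (rule Lim_null_comparison[rotated])
qed

lemma JddJ_sum_eq:
  assumes "asymp_weight w \<alpha>" "r > 0"
  shows "JddJ_sum w r = bessel_sum (sq_weight w) r / r ^ 2 - bessel_sum w r - JdJ_sum w r / r"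
proof -
  note aw = asymp_weight_subexp[OF assms(1)] asymp_weight_sq[OF assms(1), THEN asymp_weight_subexp]
  note s = sums_diff[OF sums_diff[OF sums_divide[OF bessel_product_sums(1)[OF aw(2) assms(2)], of "r ^ 2"]
      bessel_product_sums(1)[OF aw(1) assms(2)]] sums_divide[OF bessel_product_sums(2)[OF aw(1) assms(2)], of r]]
  have "(real (Suc n))\<^sup>2 * w (Suc n) * (bessel_J (Suc n) r)\<^sup>2 / r ^ 2 - w (Suc n) * (bessel_J (Suc n) r)\<^sup>2
      - w (Suc n) * (bessel_J (Suc n) r * dJ (Suc n) r) / r = w (Suc n) * (bessel_J (Suc n) r * ddJ (Suc n) r)" for n
    using assms(2) by (simp add: ddJ_eq power2_eq_square field_simps del: of_nat_Suc)
  then show ?thesis using sums_unique[OF s] by (simp only: weighted_sum_def)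
qed

lemma JddJ_sum_asymp:
  assumes "\<alpha> > -1" "asymp_weight w \<alpha>"
  shows "((\<lambda>r. JddJ_sum w r / r powr \<alpha>) \<longlongrightarrow> arcsine_moment (\<alpha> + 2) - arcsine_moment \<alpha>) at_top"
proof -
  have sq: "((\<lambda>r. (bessel_sum (sq_weight w) r / r ^ 2) / r powr \<alpha>) \<longlongrightarrow> arcsine_moment (\<alpha> + 2)) at_top"
    using bessel_sum_asymp[OF _ asymp_weight_sq[OF assms(2)]] assms(1)
    by (intro tendsto_powr_add_nat) simp
  have "((\<lambda>r. (bessel_sum (sq_weight w) r / r ^ 2 - bessel_sum w r - JdJ_sum w r / r) / r powr \<alpha>)
      \<longlongrightarrow> arcsine_moment (\<alpha> + 2) - arcsine_moment \<alpha> - 0) at_top"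
    unfolding diff_divide_distrib
    by (intro tendsto_diff sq bessel_sum_asymp JdJ_sum_over_tendsto assms)
  then have "((\<lambda>r. (bessel_sum (sq_weight w) r / r ^ 2 - bessel_sum w r - JdJ_sum w r / r) / r powr \<alpha>)
      \<longlongrightarrow> arcsine_moment (\<alpha> + 2) - arcsine_moment \<alpha>) at_top" by simp
  then show ?thesis by (rule tendsto_over_powr_cong) (simp only: JddJ_sum_eq[OF assms(2)])
qed

text \<open>
  Landau's trick: \<open>F (r + 1) - F r = o(r powr \<alpha>)\<close> is a value of \<open>G\<close> on \<open>(r, r + 1)\<close>, and \<open>G\<close> varies
  only by \<open>o(r powr \<alpha>)\<close> there.
\<close>

lemma powr_landau_derivative:
  fixes F G H :: "real \<Rightarrow> real"
  assumes F: "\<And>x. x > 0 \<Longrightarrow> (F has_real_derivative G x) (at x)"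
    and G: "\<And>x. x > 0 \<Longrightarrow> (G has_real_derivative H x) (at x)"
    and FL: "((\<lambda>r. F r / r powr \<alpha>) \<longlongrightarrow> L) at_top" and H0: "((\<lambda>r. H r / r powr \<alpha>) \<longlongrightarrow> 0) at_top"
  shows "((\<lambda>r. G r / r powr \<alpha>) \<longlongrightarrow> 0) at_top"
proof (rule tendstoI)
  fix e :: real assume e: "e > 0"
  \<comment> \<open>The bound on \<open>H\<close> is used at points y between r and r + 1 with r
    \<ge> 1. There y/r \<le> 2, so y^\<alpha> exceeds r^\<alpha> at most by the factor
    2^\<bar>\<alpha>\<bar>, which is divided out in advance.\<close>
  define \<epsilon> where "\<epsilon> = e / 2 / 2 powr \<bar>\<alpha>\<bar>"
  have \<epsilon>: "\<epsilon> > 0" "\<epsilon> * 2 powr \<bar>\<alpha>\<bar> = e / 2" using e by (auto simp: \<epsilon>_def)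
  obtain X where X: "\<And>r. r \<ge> X \<Longrightarrow> \<bar>H r / r powr \<alpha>\<bar> < \<epsilon>"
    using tendstoD[OF H0 \<epsilon>(1)] by (auto simp: eventually_at_top_linorder)
  have "filterlim (\<lambda>r. r + 1) at_top (at_top :: real filter)" by real_asymp
  from filterlim_compose[OF FL this]
  have "((\<lambda>r. F (r + 1) / (r + 1) powr \<alpha>) \<longlongrightarrow> L) at_top" .
  moreover have "((\<lambda>r. (r + 1) powr \<alpha> / r powr \<alpha>) \<longlongrightarrow> 1) at_top" by real_asymp
  ultimately have "((\<lambda>r. F (r + 1) / (r + 1) powr \<alpha> * ((r + 1) powr \<alpha> / r powr \<alpha>) - F r / r powr \<alpha>) \<longlongrightarrow> L * 1 - L) at_top"
    by (intro tendsto_diff tendsto_mult FL)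
  then have "((\<lambda>r. F (r + 1) / (r + 1) powr \<alpha> * ((r + 1) powr \<alpha> / r powr \<alpha>) - F r / r powr \<alpha>) \<longlongrightarrow> 0) at_top"
    by simp
  from tendstoD[OF this, of "e / 2"] e
  have "\<forall>\<^sub>F r in at_top. \<bar>F (r + 1) / (r + 1) powr \<alpha> * ((r + 1) powr \<alpha> / r powr \<alpha>) - F r / r powr \<alpha>\<bar> < e / 2"
    by simp
  then show "\<forall>\<^sub>F r in at_top. dist (G r / r powr \<alpha>) 0 < e"
    using eventually_ge_at_top[of X] eventually_ge_at_top[of 1]
  proof eventually_elim
    case (elim r)
    have "\<exists>z>r. z < r + 1 \<and> F (r + 1) - F r = (r + 1 - r) * G z"
      using elim(3) by (intro MVT2 F) auto
    then obtain z where z: "r < z" "z < r + 1" "F (r + 1) - F r = G z" by auto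
    have "\<exists>y>r. y < z \<and> G z - G r = (z - r) * H y"
      using elim(3) z by (intro MVT2 G) auto
    then obtain y where y: "r < y" "y < z" "G z - G r = (z - r) * H y" by auto
    have "\<bar>H y\<bar> \<le> \<epsilon> * y powr \<alpha>"
      using X[of y] y elim by (simp add: abs_divide divide_less_eq)
    also have "y powr \<alpha> = (y / r) powr \<alpha> * r powr \<alpha>" using y elim by (simp add: powr_divide)
    also have "(y / r) powr \<alpha> \<le> 2 powr \<bar>\<alpha>\<bar>"
    proof -
      have "1 \<le> y / r" "y / r \<le> 2" using y z elim by (auto simp: field_simps)
      then have "(y / r) powr \<alpha> \<le> (y / r) powr \<bar>\<alpha>\<bar>" "(y / r) powr \<bar>\<alpha>\<bar> \<le> 2 powr \<bar>\<alpha>\<bar>"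
        by (auto intro!: powr_mono powr_mono2)
      then show ?thesis by simp
    qed
    finally have "\<bar>H y\<bar> \<le> \<epsilon> * (2 powr \<bar>\<alpha>\<bar> * r powr \<alpha>)" using \<epsilon>(1) by (simp add: mult_right_mono)
    then have Hy: "\<bar>H y\<bar> \<le> e / 2 * r powr \<alpha>" using \<epsilon>(2) by (simp add: mult.assoc[symmetric])
    have "\<bar>(z - r) * H y\<bar> \<le> 1 * \<bar>H y\<bar>" unfolding abs_mult using z by (intro mult_right_mono) auto
    then have "\<bar>G r\<bar> \<le> \<bar>F (r + 1) - F r\<bar> + e / 2 * r powr \<alpha>" using y(3) z(3) Hy by linarith
    moreover have "\<bar>F (r + 1) - F r\<bar> < e / 2 * r powr \<alpha>"
    proof -
      have "F (r + 1) / (r + 1) powr \<alpha> * ((r + 1) powr \<alpha> / r powr \<alpha>) - F r / r powr \<alpha> = (F (r + 1) - F r) / r powr \<alpha>"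
        using elim(3) by (simp add: diff_divide_distrib)
      then show ?thesis using elim(1,3) by (simp add: abs_divide divide_less_eq)
    qed
    ultimately have "\<bar>G r\<bar> < e * r powr \<alpha>" by linarith
    then show ?case using elim(3) by (simp add: abs_divide divide_less_eq)
  qed
qed

lemma DERIV_JdJ_sum:
  assumes "subexp w" "r > 0"
  shows "(JdJ_sum w has_real_derivative dJdJ_sum w r + JddJ_sum w r) (at r)"
proof -
  have "(JdJ_sum w has_real_derivative (\<Sum>n. w (Suc n) * ((dJ (Suc n) r)\<^sup>2 + bessel_J (Suc n) r * ddJ (Suc n) r))) (at r)"
    unfolding weighted_sum_def
  proof (rule DERIV_weighted[OF assms(1) geo_dom_bessel_products(2) _ assms(2)])
    show "geo_dom (1/4) (\<lambda>l x. (dJ l x)\<^sup>2 + bessel_J l x * ddJ l x)"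
      by (intro geo_dom_add geo_dom_bessel_products) auto
    show "((\<lambda>x. bessel_J l x * dJ l x) has_real_derivative (dJ l x)\<^sup>2 + bessel_J l x * ddJ l x) (at x)"
      if "x > 0" for l x
      using DERIV_mult[OF DERIV_bessel_J DERIV_dJ, of x l l] that by (simp add: power2_eq_square add.commute mult.commute)
  qed
  then show ?thesis
    using sums_unique[OF sums_add[OF bessel_product_sums(3)[OF assms] bessel_product_sums(4)[OF assms]]]
    by (simp add: distrib_left)
qed

lemma JdJ_sum_asymp:
  assumes "\<alpha> > -1" "asymp_weight w \<alpha>"
  shows "((\<lambda>r. JdJ_sum w r / r powr \<alpha>) \<longlongrightarrow> 0) at_top"
proof -
  note s = asymp_weight_subexp[OF assms(2)]
  have "((\<lambda>r. (2 * JdJ_sum w r) / r powr \<alpha>) \<longlongrightarrow> 0) at_top"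
  proof (rule powr_landau_derivative)
    show "(bessel_sum w has_real_derivative 2 * JdJ_sum w x) (at x)" if "x > 0" for x
      using DERIV_bessel_sum[OF s that] by (simp add: weighted_sum_def)
    show "((\<lambda>x. 2 * JdJ_sum w x) has_real_derivative 2 * (dJdJ_sum w x + JddJ_sum w x)) (at x)" if "x > 0" for x
      by (rule DERIV_cmult) (rule DERIV_JdJ_sum[OF s that])
    show "((\<lambda>r. bessel_sum w r / r powr \<alpha>) \<longlongrightarrow> arcsine_moment \<alpha>) at_top"
      by (rule bessel_sum_asymp[OF assms])
    have "((\<lambda>r. 2 * (dJdJ_sum w r / r powr \<alpha> + JddJ_sum w r / r powr \<alpha>)) \<longlongrightarrow>
        2 * ((arcsine_moment \<alpha> - arcsine_moment (\<alpha> + 2)) + (arcsine_moment (\<alpha> + 2) - arcsine_moment \<alpha>))) at_top"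
      by (intro tendsto_mult_left tendsto_add dJdJ_sum_asymp JddJ_sum_asymp assms)
    then show "((\<lambda>r. 2 * (dJdJ_sum w r + JddJ_sum w r) / r powr \<alpha>) \<longlongrightarrow> 0) at_top"
      by (simp add: add_divide_distrib distrib_left)
  qed
  from tendsto_mult_left[OF this, of "1/2"] show ?thesis by simp
qed

text \<open>Bessel's equation multiplied by J_l'. The term with n^2 is of the type J_l J_l' at
  exponent \<alpha> + 2, so it is negligible after division by r^2.\<close>

lemma dJddJ_sum_eq:
  assumes "asymp_weight w \<alpha>" "r > 0"
  shows "dJddJ_sum w r = JdJ_sum (sq_weight w) r / r ^ 2 - JdJ_sum w r - dJdJ_sum w r / r ^ 1"
proof -
  note aw = asymp_weight_subexp[OF assms(1)] asymp_weight_sq[OF assms(1), THEN asymp_weight_subexp]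
  note s = sums_diff[OF sums_diff[OF sums_divide[OF bessel_product_sums(2)[OF aw(2) assms(2)], of "r ^ 2"]
      bessel_product_sums(2)[OF aw(1) assms(2)]] sums_divide[OF bessel_product_sums(3)[OF aw(1) assms(2)], of "r ^ 1"]]
  have "(real (Suc n))\<^sup>2 * w (Suc n) * (bessel_J (Suc n) r * dJ (Suc n) r) / r ^ 2
      - w (Suc n) * (bessel_J (Suc n) r * dJ (Suc n) r)
      - w (Suc n) * (dJ (Suc n) r)\<^sup>2 / r ^ 1 = w (Suc n) * (dJ (Suc n) r * ddJ (Suc n) r)" for n
    using assms(2) by (simp add: ddJ_eq power2_eq_square field_simps del: of_nat_Suc)
  then show ?thesis using sums_unique[OF s] by (simp only: weighted_sum_def)
qed

lemma JdJ_sum_sq_asymp: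
  assumes "\<alpha> > -1" "asymp_weight w \<alpha>"
  shows "((\<lambda>r. (JdJ_sum (sq_weight w) r / r ^ 2) / r powr \<alpha>) \<longlongrightarrow> 0) at_top"
  using JdJ_sum_asymp[OF _ asymp_weight_sq[OF assms(2)]] assms(1)
  by (intro tendsto_powr_add_nat) simp

lemma dJddJ_sum_asymp:
  assumes "\<alpha> > -1" "asymp_weight w \<alpha>"
  shows "((\<lambda>r. dJddJ_sum w r / r powr \<alpha>) \<longlongrightarrow> 0) at_top"
proof -
  have "((\<lambda>r. (JdJ_sum (sq_weight w) r / r ^ 2 - JdJ_sum w r - dJdJ_sum w r / r ^ 1) / r powr \<alpha>)
      \<longlongrightarrow> 0 - 0 - 0) at_top"
    unfolding diff_divide_distrib
    by (intro tendsto_diff JdJ_sum_sq_asymp JdJ_sum_asymp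
        tendsto_div_power_powr_zero[OF dJdJ_sum_asymp] assms) simp
  then have "((\<lambda>r. (JdJ_sum (sq_weight w) r / r ^ 2 - JdJ_sum w r - dJdJ_sum w r / r ^ 1) / r powr \<alpha>)
      \<longlongrightarrow> 0) at_top" by simp
  then show ?thesis by (rule tendsto_over_powr_cong) (simp only: dJddJ_sum_eq[OF assms(2)])
qed

lemma ddJddJ_sum_eq:
  assumes "asymp_weight w \<alpha>" "r > 0"
  shows "ddJddJ_sum w r = dJdJ_sum w r / r ^ 2 + 2 * (JdJ_sum w r / r)
    - 2 * ((JdJ_sum (sq_weight w) r / r ^ 2) / r) + bessel_sum w r - 2 * (bessel_sum (sq_weight w) r / r ^ 2)
    + bessel_sum (sq_weight (sq_weight w)) r / r ^ 4"
proof -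
  note aw = asymp_weight_subexp[OF assms(1)] asymp_weight_sq[OF assms(1), THEN asymp_weight_subexp]
    asymp_weight_sq[OF asymp_weight_sq[OF assms(1)], THEN asymp_weight_subexp]
  note S = bessel_product_sums[OF aw(1) assms(2)] and S2 = bessel_product_sums[OF aw(2) assms(2)]
  have s: "(\<lambda>n. w (Suc n) * (dJ (Suc n) r)\<^sup>2 / r ^ 2 + 2 * (w (Suc n) * (bessel_J (Suc n) r * dJ (Suc n) r) / r)
      - 2 * ((real (Suc n))\<^sup>2 * w (Suc n) * (bessel_J (Suc n) r * dJ (Suc n) r) / r ^ 2 / r)
      + w (Suc n) * (bessel_J (Suc n) r)\<^sup>2
      - 2 * ((real (Suc n))\<^sup>2 * w (Suc n) * (bessel_J (Suc n) r)\<^sup>2 / r ^ 2)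
      + (real (Suc n))\<^sup>2 * ((real (Suc n))\<^sup>2 * w (Suc n)) * (bessel_J (Suc n) r)\<^sup>2 / r ^ 4) sums
    (dJdJ_sum w r / r ^ 2 + 2 * (JdJ_sum w r / r)
    - 2 * ((JdJ_sum (sq_weight w) r / r ^ 2) / r) + bessel_sum w r - 2 * (bessel_sum (sq_weight w) r / r ^ 2)
    + bessel_sum (sq_weight (sq_weight w)) r / r ^ 4)"
    by (intro sums_add sums_diff sums_mult sums_divide S S2 bessel_sum_sums[OF aw(3) assms(2)])
  have "w (Suc n) * (dJ (Suc n) r)\<^sup>2 / r ^ 2 + 2 * (w (Suc n) * (bessel_J (Suc n) r * dJ (Suc n) r) / r)
      - 2 * ((real (Suc n))\<^sup>2 * w (Suc n) * (bessel_J (Suc n) r * dJ (Suc n) r) / r ^ 2 / r)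
      + w (Suc n) * (bessel_J (Suc n) r)\<^sup>2
      - 2 * ((real (Suc n))\<^sup>2 * w (Suc n) * (bessel_J (Suc n) r)\<^sup>2 / r ^ 2)
      + (real (Suc n))\<^sup>2 * ((real (Suc n))\<^sup>2 * w (Suc n)) * (bessel_J (Suc n) r)\<^sup>2 / r ^ 4
      = w (Suc n) * (ddJ (Suc n) r)\<^sup>2" for n
  proof -
    have "W * d\<^sup>2 / r ^ 2 + 2 * (W * (j * d) / r) - 2 * (l\<^sup>2 * W * (j * d) / r ^ 2 / r) + W * j\<^sup>2
        - 2 * (l\<^sup>2 * W * j\<^sup>2 / r ^ 2) + l\<^sup>2 * (l\<^sup>2 * W) * j\<^sup>2 / r ^ 4
        = W * (- d / r - (1 - (l / r)\<^sup>2) * j)\<^sup>2" for W d j l :: real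
    proof -
      \<comment> \<open>Replacing divisions by powers of 1/r turns the claim into a polynomial
        identity.\<close>
      define h where "h = 1 / r"
      have "x / r = x * h" "x / r ^ 2 = x * h ^ 2" "x / r ^ 4 = x * h ^ 4" for x
        by (simp_all add: h_def power_divide)
      then show ?thesis by (simp only:) (simp add: power2_eq_square algebra_simps power4_eq_xxxx)
    qed
    then show ?thesis using assms(2) by (simp only: ddJ_eq[OF less_imp_neq[OF assms(2), symmetric]])
  qed
  then show ?thesis using sums_unique[OF s] by (simp only: weighted_sum_def)
qed

text \<open>Only the square of (1 - (l/r)^2) J_l survives when Bessel's equation is squared; every
  term containing J_l' carries an additional negative power of r. The limit is the arcsine integral
  of s^\<alpha> (1 - s^2)^2.\<close>

lemma ddJddJ_sum_asymp:
  assumes "\<alpha> > -1" "asymp_weight w \<alpha>"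
  shows "((\<lambda>r. ddJddJ_sum w r / r powr \<alpha>) \<longlongrightarrow>
    arcsine_moment \<alpha> - 2 * arcsine_moment (\<alpha> + 2) + arcsine_moment (\<alpha> + 4)) at_top"
proof -
  have sq: "((\<lambda>r. (bessel_sum (sq_weight w) r / r ^ 2) / r powr \<alpha>) \<longlongrightarrow> arcsine_moment (\<alpha> + 2)) at_top"
    using bessel_sum_asymp[OF _ asymp_weight_sq[OF assms(2)]] assms(1)
    by (intro tendsto_powr_add_nat) simp
  have sq2: "((\<lambda>r. (bessel_sum (sq_weight (sq_weight w)) r / r ^ 4) / r powr \<alpha>) \<longlongrightarrow> arcsine_moment (\<alpha> + 4)) at_top"
    using bessel_sum_asymp[OF _ asymp_weight_sq[OF asymp_weight_sq[OF assms(2)]]] assms(1)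
    by (intro tendsto_powr_add_nat) (simp add: add.commute)
  have sq3: "((\<lambda>r. (JdJ_sum (sq_weight w) r / r ^ 2) / r / r powr \<alpha>) \<longlongrightarrow> 0) at_top"
    using tendsto_div_power_powr_zero[OF JdJ_sum_sq_asymp[OF assms], of 1] by simp
  have "((\<lambda>r. (dJdJ_sum w r / r ^ 2) / r powr \<alpha> + 2 * ((JdJ_sum w r / r) / r powr \<alpha>)
      - 2 * ((JdJ_sum (sq_weight w) r / r ^ 2) / r / r powr \<alpha>) + bessel_sum w r / r powr \<alpha>
      - 2 * ((bessel_sum (sq_weight w) r / r ^ 2) / r powr \<alpha>)
      + (bessel_sum (sq_weight (sq_weight w)) r / r ^ 4) / r powr \<alpha>) \<longlongrightarrow>
      0 + 2 * 0 - 2 * 0 + arcsine_moment \<alpha> - 2 * arcsine_moment (\<alpha> + 2) + arcsine_moment (\<alpha> + 4)) at_top"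
    by (intro tendsto_add tendsto_diff tendsto_mult_left sq sq2 sq3 bessel_sum_asymp JdJ_sum_over_tendsto
        tendsto_div_power_powr_zero[OF dJdJ_sum_asymp] assms) simp
  then have "((\<lambda>r. (dJdJ_sum w r / r ^ 2 + 2 * (JdJ_sum w r / r)
    - 2 * ((JdJ_sum (sq_weight w) r / r ^ 2) / r) + bessel_sum w r - 2 * (bessel_sum (sq_weight w) r / r ^ 2)
    + bessel_sum (sq_weight (sq_weight w)) r / r ^ 4) / r powr \<alpha>) \<longlongrightarrow>
      arcsine_moment \<alpha> - 2 * arcsine_moment (\<alpha> + 2) + arcsine_moment (\<alpha> + 4)) at_top"
    by (simp only: add_divide_distrib diff_divide_distrib times_divide_eq_right) simp
  then show ?thesis by (rule tendsto_over_powr_cong) (simp only: ddJddJ_sum_eq[OF assms(2)])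
qed

section \<open>Closed forms of the constants by Gamma functions\<close>

lemma arcsine_moment_Gamma_quotient:
  "arcsine_moment \<alpha> = Gamma ((\<alpha> + 1) / 2) / (2 * sqrt pi * Gamma (\<alpha> / 2 + 1))"
proof -
  have "(\<alpha> + 1) / 2 + 1 / 2 = \<alpha> / 2 + 1" by (simp add: field_simps)
  then have "arcsine_moment \<alpha> = Gamma ((\<alpha> + 1) / 2) * sqrt pi / Gamma (\<alpha> / 2 + 1) / (2 * (sqrt pi * sqrt pi))"
    by (simp add: arcsine_moment_def Beta_def Gamma_one_half_real)
  also have "\<dots> = Gamma ((\<alpha> + 1) / 2) / (2 * sqrt pi * Gamma (\<alpha> / 2 + 1))"
  proof -
    have "a * p / g / (2 * (p * p)) = a / (2 * p * g)" if "p \<noteq> 0" for a p g :: real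
      using that by simp
    moreover have "sqrt pi \<noteq> 0" by simp
    ultimately show ?thesis by blast
  qed
  finally show ?thesis .
qed

lemma Gamma_half_add:
  fixes \<alpha> :: real
  assumes "\<alpha> > -1"
  shows "Gamma (\<alpha> / 2 + 2) = (\<alpha> + 2) / 2 * Gamma (\<alpha> / 2 + 1)"
    "Gamma (\<alpha> / 2 + 3) = (\<alpha> + 2) * (\<alpha> + 4) / 4 * Gamma (\<alpha> / 2 + 1)"
proof -
  have "Gamma (y + 1) = y * Gamma y" if "y > 0" for y :: real
    by (rule Gamma_plus1) (use that in \<open>auto dest: nonpos_Ints_nonpos\<close>)
  from this[of "\<alpha> / 2 + 1"] this[of "\<alpha> / 2 + 2"]
  have g: "Gamma (\<alpha> / 2 + 2) = (\<alpha> / 2 + 1) * Gamma (\<alpha> / 2 + 1)"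
    "Gamma (\<alpha> / 2 + 3) = (\<alpha> / 2 + 2) * Gamma (\<alpha> / 2 + 2)"
    using assms by (simp_all add: add.commute)
  show "Gamma (\<alpha> / 2 + 2) = (\<alpha> + 2) / 2 * Gamma (\<alpha> / 2 + 1)"
    unfolding g(1) by (simp add: add_divide_distrib)
  have "(\<alpha> / 2 + 2) * ((\<alpha> / 2 + 1) * y) = (\<alpha> + 2) * (\<alpha> + 4) / 4 * y" for y
    by (simp add: field_simps)
  then show "Gamma (\<alpha> / 2 + 3) = (\<alpha> + 2) * (\<alpha> + 4) / 4 * Gamma (\<alpha> / 2 + 1)"
    unfolding g(2) unfolding g(1) .
qed

lemma Gamma_legendre_duplication_real:
  fixes x :: real
  assumes "x > 0"
  shows "Gamma x * Gamma (x + 1/2) = exp ((1 - 2 * x) * ln 2) * sqrt pi * Gamma (2 * x)"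
proof -
  have np: "y \<notin> \<int>\<^sub>\<le>\<^sub>0" if "y > 0" for y :: real using that by (auto dest: nonpos_Ints_nonpos)
  have r: "complex_of_real x + 1/2 = of_real (x + 1/2)" "2 * complex_of_real x = of_real (2 * x)"
    "(1 - complex_of_real (2 * x)) * of_real (ln 2) = of_real ((1 - 2 * x) * ln 2)" by simp_all
  have "Gamma (complex_of_real x) * Gamma (complex_of_real x + 1/2)
      = exp ((1 - 2 * complex_of_real x) * of_real (ln 2)) * of_real (sqrt pi) * Gamma (2 * complex_of_real x)"
    using assms by (intro Gamma_legendre_duplication) (simp_all only: r of_real_in_nonpos_Ints_iff np not_False_eq_True)
  then have "complex_of_real (Gamma x * Gamma (x + 1/2))
      = complex_of_real (exp ((1 - 2 * x) * ln 2) * sqrt pi * Gamma (2 * x))"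
    unfolding r Gamma_complex_of_real exp_of_real of_real_mult[symmetric] .
  then show ?thesis by (simp only: of_real_eq_iff)
qed

text \<open>Multiplying numerator and denominator of the Gamma quotient by Gamma(\<alpha>/2 + 1)
  creates the product in Legendre's duplication formula at x = (\<alpha> + 1)/2.\<close>

lemma arcsine_moment_duplication:
  assumes "\<alpha> > -1"
  shows "arcsine_moment \<alpha> = 2 powr (- \<alpha> - 1) * Gamma (\<alpha> + 1) / (Gamma (\<alpha> / 2 + 1))\<^sup>2"
proof -
  define x where "x = (\<alpha> + 1) / 2"
  have x: "x > 0" "x + 1/2 = \<alpha> / 2 + 1" "2 * x = \<alpha> + 1" using assms by (simp_all add: x_def field_simps)
  have "Gamma x * Gamma (x + 1/2) = exp ((1 - 2 * x) * ln 2) * sqrt pi * Gamma (2 * x)"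
    using x(1) by (rule Gamma_legendre_duplication_real)
  also have "exp ((1 - 2 * x) * ln 2) = 2 powr (- \<alpha>)"
    by (simp add: powr_def x(3))
  finally have 1: "Gamma x * Gamma (\<alpha> / 2 + 1) = 2 powr (- \<alpha>) * sqrt pi * Gamma (\<alpha> + 1)"
    unfolding x(2,3) .
  have G: "Gamma (\<alpha> / 2 + 1) \<noteq> 0"
    by (rule less_imp_neq[OF Gamma_real_pos, symmetric]) (use assms in simp)
  have "arcsine_moment \<alpha> = Gamma x * Gamma (\<alpha> / 2 + 1) / (2 * sqrt pi * (Gamma (\<alpha> / 2 + 1))\<^sup>2)"
    using G by (simp add: arcsine_moment_Gamma_quotient x_def power2_eq_square)
  also have "\<dots> = 2 powr (- \<alpha>) / 2 * Gamma (\<alpha> + 1) / (Gamma (\<alpha> / 2 + 1))\<^sup>2"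
    unfolding 1 by simp
  also have "2 powr (- \<alpha>) / 2 = 2 powr (- \<alpha> - 1)" by (simp add: powr_diff)
  finally show ?thesis .
qed

text \<open>The factor 1 - (\<alpha>+1)/(\<alpha>+2) = 1/(\<alpha>+2) is absorbed by raising the
  Gamma argument in the denominator by one.\<close>

lemma arcsine_moment_first_difference:
  assumes "\<alpha> > -1"
  shows "arcsine_moment \<alpha> - arcsine_moment (\<alpha> + 2) = Gamma ((\<alpha> + 1) / 2) / (4 * sqrt pi * Gamma (\<alpha> / 2 + 2))"
proof -
  have G: "Gamma (\<alpha> / 2 + 1) \<noteq> 0"
    by (rule less_imp_neq[OF Gamma_real_pos, symmetric]) (use assms in simp)
  have "arcsine_moment \<alpha> - arcsine_moment (\<alpha> + 2) = arcsine_moment \<alpha> / (\<alpha> + 2)"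
    using assms unfolding arcsine_moment_add_2[OF assms] by (simp add: field_simps)
  also have "\<dots> = Gamma ((\<alpha> + 1) / 2) / (4 * sqrt pi * Gamma (\<alpha> / 2 + 2))"
    unfolding arcsine_moment_Gamma_quotient Gamma_half_add(1)[OF assms] by simp
  finally show ?thesis .
qed

text \<open>Over the common denominator (\<alpha>+2)(\<alpha>+4) the numerator collapses to 3.
  Passing from Gamma(\<alpha>/2 + 1)^2 to Gamma(\<alpha>/2 + 3)^2 brings the square of
  (\<alpha>+2)(\<alpha>+4)/4: the 16 lowers the power of 2 by four, and one factor
  (\<alpha>+2)(\<alpha>+4) remains in the numerator.\<close>

lemma arcsine_moment_second_difference:
  assumes "\<alpha> > -1"
  shows "arcsine_moment \<alpha> - 2 * arcsine_moment (\<alpha> + 2) + arcsine_moment (\<alpha> + 4)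
    = 3 * 2 powr (- \<alpha> - 5) * (\<alpha> + 2) * (\<alpha> + 4) * Gamma (\<alpha> + 1) / (Gamma (\<alpha> / 2 + 3))\<^sup>2"
proof -
  define g where "g = Gamma (\<alpha> / 2 + 1)"
  define t where "t = 2 powr (- \<alpha> - 1)"
  have G: "g \<noteq> 0" unfolding g_def
    by (rule less_imp_neq[OF Gamma_real_pos, symmetric]) (use assms in simp)
  have 4: "arcsine_moment (\<alpha> + 4) = (\<alpha> + 3) / (\<alpha> + 4) * arcsine_moment (\<alpha> + 2)"
    using arcsine_moment_add_2[of "\<alpha> + 2"] assms by (simp add: add.assoc)
  have "- \<alpha> - 5 = (- \<alpha> - 1) - 4" by simp
  then have "2 powr (- \<alpha> - 5) = 2 powr ((- \<alpha> - 1) - 4)" by (simp only:)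
  also have "\<dots> = t / 16" unfolding powr_diff t_def by simp
  finally have t: "2 powr (- \<alpha> - 5) = t / 16" .
  have p: "\<alpha> + 2 \<noteq> 0" "\<alpha> + 4 \<noteq> 0" using assms by auto
  have "arcsine_moment \<alpha> - 2 * arcsine_moment (\<alpha> + 2) + arcsine_moment (\<alpha> + 4)
      = 3 * arcsine_moment \<alpha> / ((\<alpha> + 2) * (\<alpha> + 4))"
    unfolding 4 arcsine_moment_add_2[OF assms] using p
    by (simp add: divide_simps) (simp add: algebra_simps)
  also have "\<dots> = 3 * (t / 16) * (\<alpha> + 2) * (\<alpha> + 4) * Gamma (\<alpha> + 1) / ((\<alpha> + 2) * (\<alpha> + 4) / 4 * g)\<^sup>2"
    unfolding arcsine_moment_duplication[OF assms] g_def[symmetric] t_def[symmetric] using p G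
    by (simp add: divide_simps power2_eq_square)
  finally show ?thesis unfolding t Gamma_half_add(2)[OF assms] g_def .
qed

lemma smallo_powrI:
  assumes "((\<lambda>r. f r / r powr \<alpha>) \<longlongrightarrow> c) at_top"
  shows "(\<lambda>r. f r - c * r powr \<alpha>) \<in> o[at_top](\<lambda>r::real. r powr \<alpha>)"
proof (rule smalloI_tendsto)
  have "((\<lambda>r. f r / r powr \<alpha> - c) \<longlongrightarrow> c - c) at_top" by (intro tendsto_diff assms tendsto_const)
  moreover have "\<forall>\<^sub>F r in at_top. f r / r powr \<alpha> - c = (f r - c * r powr \<alpha>) / r powr \<alpha>"
    using eventually_gt_at_top[of 0] by eventually_elim (simp add: diff_divide_distrib)
  ultimately show "((\<lambda>r. (f r - c * r powr \<alpha>) / r powr \<alpha>) \<longlongrightarrow> 0) at_top"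
    by (simp add: Lim_transform_eventually)
  show "\<forall>\<^sub>F r in at_top. r powr \<alpha> \<noteq> (0::real)"
    using eventually_gt_at_top[of 0] by eventually_elim simp
qed

theorem corollary6p1:
  fixes \<alpha> \<beta> :: real
  assumes "\<alpha> > -1" and "\<beta> > -1"
  shows "(\<forall>r>0.
        summable (\<lambda>n. (real (Suc n) + \<beta>) powr \<alpha> * (bessel_J (Suc n) r)\<^sup>2) \<and>
        summable (\<lambda>n. (real (Suc n) + \<beta>) powr \<alpha> * (bessel_J (Suc n) r * deriv (bessel_J (Suc n)) r)) \<and>
        summable (\<lambda>n. (real (Suc n) + \<beta>) powr \<alpha> * (deriv (bessel_J (Suc n)) r)\<^sup>2) \<and>
        summable (\<lambda>n. (real (Suc n) + \<beta>) powr \<alpha> * (bessel_J (Suc n) r * deriv (deriv (bessel_J (Suc n))) r)) \<and>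
        summable (\<lambda>n. (real (Suc n) + \<beta>) powr \<alpha> * (deriv (bessel_J (Suc n)) r * deriv (deriv (bessel_J (Suc n))) r)) \<and>
        summable (\<lambda>n. (real (Suc n) + \<beta>) powr \<alpha> * (deriv (deriv (bessel_J (Suc n))) r)\<^sup>2)) \<and>
      (\<lambda>r. (\<Sum>n. (real (Suc n) + \<beta>) powr \<alpha> * (bessel_J (Suc n) r)\<^sup>2)
          - (2 powr (- \<alpha> - 1) * Gamma (\<alpha> + 1) / (Gamma (\<alpha> / 2 + 1))\<^sup>2) * r powr \<alpha>)
        \<in> o[at_top](\<lambda>r. r powr \<alpha>) \<and>
      (\<lambda>r. (\<Sum>n. (real (Suc n) + \<beta>) powr \<alpha> * (bessel_J (Suc n) r * deriv (bessel_J (Suc n)) r)))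
        \<in> o[at_top](\<lambda>r. r powr \<alpha>) \<and>
      (\<lambda>r. (\<Sum>n. (real (Suc n) + \<beta>) powr \<alpha> * (deriv (bessel_J (Suc n)) r)\<^sup>2)
          - (Gamma ((\<alpha> + 1) / 2) / (4 * sqrt pi * Gamma (\<alpha> / 2 + 2))) * r powr \<alpha>)
        \<in> o[at_top](\<lambda>r. r powr \<alpha>) \<and>
      (\<lambda>r. (\<Sum>n. (real (Suc n) + \<beta>) powr \<alpha> * (bessel_J (Suc n) r * deriv (deriv (bessel_J (Suc n))) r))
          - (- Gamma ((\<alpha> + 1) / 2) / (4 * sqrt pi * Gamma (\<alpha> / 2 + 2))) * r powr \<alpha>)
        \<in> o[at_top](\<lambda>r. r powr \<alpha>) \<and>
      (\<lambda>r. (\<Sum>n. (real (Suc n) + \<beta>) powr \<alpha> * (deriv (bessel_J (Suc n)) r * deriv (deriv (bessel_J (Suc n))) r)))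
        \<in> o[at_top](\<lambda>r. r powr \<alpha>) \<and>
      (\<lambda>r. (\<Sum>n. (real (Suc n) + \<beta>) powr \<alpha> * (deriv (deriv (bessel_J (Suc n))) r)\<^sup>2)
          - (3 * 2 powr (- \<alpha> - 5) * (\<alpha> + 2) * (\<alpha> + 4) * Gamma (\<alpha> + 1) / (Gamma (\<alpha> / 2 + 3))\<^sup>2) * r powr \<alpha>)
        \<in> o[at_top](\<lambda>r. r powr \<alpha>)"
proof -
  define w where "w n = (real n + \<beta>) powr \<alpha>" for n
  have aw: "asymp_weight w \<alpha>" unfolding w_def by (rule asymp_weight_shifted_powr)
  note s = asymp_weight_subexp[OF aw]
  note sums = bessel_product_sums[OF s, THEN sums_summable]
  note W = w_def[of "Suc n" for n, symmetric]
  have 1: "(\<lambda>r. bessel_sum w r - (2 powr (- \<alpha> - 1) * Gamma (\<alpha> + 1) / (Gamma (\<alpha> / 2 + 1))\<^sup>2) * r powr \<alpha>)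
      \<in> o[at_top](\<lambda>r. r powr \<alpha>)"
    using smallo_powrI[OF bessel_sum_asymp[OF assms(1) aw]] arcsine_moment_duplication[OF assms(1)] by simp
  have 2: "JdJ_sum w \<in> o[at_top](\<lambda>r. r powr \<alpha>)"
    using smallo_powrI[OF JdJ_sum_asymp[OF assms(1) aw]] by simp
  have 3: "(\<lambda>r. dJdJ_sum w r - (Gamma ((\<alpha> + 1) / 2) / (4 * sqrt pi * Gamma (\<alpha> / 2 + 2))) * r powr \<alpha>)
      \<in> o[at_top](\<lambda>r. r powr \<alpha>)"
    using smallo_powrI[OF dJdJ_sum_asymp[OF assms(1) aw]]
    by (simp only: arcsine_moment_first_difference[OF assms(1)])
  have "arcsine_moment (\<alpha> + 2) - arcsine_moment \<alpha> = - Gamma ((\<alpha> + 1) / 2) / (4 * sqrt pi * Gamma (\<alpha> / 2 + 2))"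
    using arcsine_moment_first_difference[OF assms(1)] by (simp only: minus_divide_left[symmetric])
  with smallo_powrI[OF JddJ_sum_asymp[OF assms(1) aw]]
  have 4: "(\<lambda>r. JddJ_sum w r - (- Gamma ((\<alpha> + 1) / 2) / (4 * sqrt pi * Gamma (\<alpha> / 2 + 2))) * r powr \<alpha>)
      \<in> o[at_top](\<lambda>r. r powr \<alpha>)"
    by (simp only:)
  have 5: "dJddJ_sum w \<in> o[at_top](\<lambda>r. r powr \<alpha>)"
    using smallo_powrI[OF dJddJ_sum_asymp[OF assms(1) aw]] by simp
  have 6: "(\<lambda>r. ddJddJ_sum w r - (3 * 2 powr (- \<alpha> - 5) * (\<alpha> + 2) * (\<alpha> + 4) * Gamma (\<alpha> + 1) / (Gamma (\<alpha> / 2 + 3))\<^sup>2) * r powr \<alpha>)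
      \<in> o[at_top](\<lambda>r. r powr \<alpha>)"
    using smallo_powrI[OF ddJddJ_sum_asymp[OF assms(1) aw]]
    by (simp only: arcsine_moment_second_difference[OF assms(1)])
  show ?thesis
    unfolding W
    by (intro conjI allI impI sums 1[unfolded bessel_sum_def] 2[unfolded weighted_sum_def[abs_def]]
        3[unfolded weighted_sum_def] 4[unfolded weighted_sum_def] 5[unfolded weighted_sum_def[abs_def]]
        6[unfolded weighted_sum_def])
qed

end
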